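(* Let $\Gamma$ be a tropical curve with model $(G=(V,E),\ell)$ and let $T=(V,F)$ be a spanning tree of $G$, with $F^c=E\setminus F$. Then the unpointed tropical Ceresa class of $\Gamma$ is $$\overline{\mathbf v}(\Gamma)=\sum_{e\in F,\ \varepsilon\in F^c}\overline{\mathrm{sgn}}_T(e,\varepsilon)\,\ell(e)\;\mathsf a_\varepsilon\otimes(\mathsf b_\varepsilon\wedge\mathsf b_e)\qquad\text{in }\ \overline{\mathrm{JH}}_{2,1}(\mathrm{Jac}(\Gamma)).$$
   Context: $\Gamma$ is a connected tropical curve (compact metric graph) of genus (first Betti number) $g\ge2$ with model $(G,\ell)$: $G=(V,E)$ a finite connected graph, $\ell\colon E\to\mathbb R_{>0}$. Edges are oriented; $s_e$, $t_e$ are source and target of $e$. One assumes $G$ has no separating edges (the maps to the Jacobian below contract them). **Jacobian.** $H_{\mathbb Z}=\mathrm H_1(\Gamma,\mathbb Z)$. $\Omega_{\mathbb Z}$ is the group of integral harmonic $1$-forms: functions $\omega\colon E\to\mathbb Z$ with $\sum_{s_e=v}\omega(e)=\sum_{t_e=v}\omega(e)$ for all $v\in V$; $\Omega=\Omega_{\mathbb Z}\otimes\mathbb R$. For a path or $1$-chain $\gamma$ in $\Gamma$, $\mathbf I_\gamma\in\Omega^\vee$ is $\omega\mapsto\int_\gamma\omega$, so $\mathbf I_e(\omega)=\ell(e)\omega(e)$. Via $\gamma\mapsto\mathbf I_\gamma$, $H_{\mathbb Z}$ is a full-rank lattice in $\Omega^\vee$, and $\mathrm{Jac}(\Gamma)=\Omega^\vee/H_{\mathbb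 Z}$, a tropical variety with tangent spaces $\Omega^\vee$ and integral affine structure given by the lattice $\Omega_{\mathbb Z}^\vee\subset\Omega^\vee$. **Homology of the Jacobian.** $\mathrm C_{p,q}(\mathrm{Jac}(\Gamma),\mathbb R)$, resp. $\mathrm C_{p,q}(\mathrm{Jac}(\Gamma),\mathbb Z)$, are (polyhedral) $q$-chains on $\mathrm{Jac}(\Gamma)$ with coefficients in $\bigwedge^p\Omega^\vee$, resp. $\bigwedge^p\Omega^\vee_{\mathbb Z}$, written as sums of $[P,v]$. Homology: $\mathrm H_{p,q}(\mathrm{Jac}(\Gamma),\mathbb R)=\bigwedge^qH\otimes\bigwedge^p\Omega^\vee$ with $H=H_{\mathbb Z}\otimes\mathbb R$, and similarly over $\mathbb Z$ with $H_{\mathbb Z}$, $\Omega_{\mathbb Z}^\vee$. The monodromy operator is $\mathrm N([P,v])=\sum_Q\mathrm{sgn}(P,Q)[Q,(o_P-o_Q)\wedge v]$ over facets $Q$ of $P$, where $\mathrm{sgn}(P,Q)$ is the sign of $Q$ in $\partial P$, $o_P\in P$ are chosen points of the cells, and $o_P-o_Q\in\Omega^\vee$ is computed in a lift to the universal cover. It commutes with $\partial$. Set $\mathrm L_{2,1}=\mathrm N(\mathrm H_{1,2}(\mathrm{Jac}(\Gamma),\mathbb Z))$ (the subgroup generated by the elements $a\otimes(a'\wedge b)-a'\otimes(a\wedge b)$ for $a,a'\in H_{\mathbb Z}$, $b\in\Omega_{\mathbb Z}^\vee$) and $\mathrm{JH}_{2,1}(\mathrm{Jac}(\Gamma))=\mathrm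 H_{2,1}(\mathrm{Jac}(\Gamma),\mathbb R)/\mathrm L_{2,1}$. **Ceresa class.** For $\flat\in\Gamma$, $\Gamma_\flat$ and $\Gamma_\flat^-$ are the images of $\Gamma$ in $\mathrm{Jac}(\Gamma)$ under $x\mapsto\mathbf I_{\gamma_x}$ and $x\mapsto-\mathbf I_{\gamma_x}$, $\gamma_x$ a path from $\flat$ to $x$; they are tropical $1$-cycles (weights $1$). The fundamental chain of a tropical $1$-cycle is the sum of $[P,\mathfrak v_P]$, $P$ running over its oriented edges and $\mathfrak v_P$ the primitive integral tangent vector in the direction of $P$. The Ceresa cycle is $\nu_\flat(\Gamma)=[\Gamma_\flat]-[\Gamma^-_\flat]$; it is null-homologous. The pointed Ceresa class $\mathbf v_\flat(\Gamma)$ is the class in $\mathrm{JH}_{2,1}(\mathrm{Jac}(\Gamma))$ of $\mathrm N(\xi)$ for any $\xi\in\mathrm C_{1,2}(\mathrm{Jac}(\Gamma),\mathbb Z)$ whose boundary is the fundamental chain of $\nu_\flat(\Gamma)$ (independent of choices). **Unpointed class.** Put $\mathsf b_e=\mathbf I_e/\ell(e)\in\Omega_{\mathbb Z}^\vee$, i.e. $\omega\mapsto\omega(e)$, for $e\in E$. For $\varepsilon\in F^c$, $\mathsf a_\varepsilon\in H_{\mathbb Z}$ is the class of the unique cycle $\gamma_T(\varepsilon)$ contained in $T\cup\varepsilon$, oriented along $\varepsilon$. Let $\omega=\sum_{\varepsilon\in F^c}\mathsf a_\varepsilon\otimes\mathsf b_\varepsilon\in\mathrm H_{1,1}(\mathrm{Jac}(\Gamma))$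 (independent of the choices), and $\omega\wedge v=\sum_\varepsilon\mathsf a_\varepsilon\otimes(\mathsf b_\varepsilon\wedge v)$ for $v\in\Omega^\vee=\mathrm H_{1,0}(\mathrm{Jac}(\Gamma),\mathbb R)$. Then $$\overline{\mathrm{JH}}_{2,1}(\mathrm{Jac}(\Gamma))=\frac{\mathrm H_{2,1}(\mathrm{Jac}(\Gamma),\mathbb R)}{\omega\wedge\mathrm H_{1,0}(\mathrm{Jac}(\Gamma),\mathbb R)+\mathrm L_{2,1}},$$ and $\overline{\mathbf v}(\Gamma)$ is the image of $\mathbf v_\flat(\Gamma)$ in it; it does not depend on $\flat$. **Sign.** For $e\in F$, $\varepsilon\in F^c$: $\overline{\mathrm{sgn}}_T(e,\varepsilon)=0$ if $e\in\gamma_T(\varepsilon)$; otherwise it is $1$ if $e$ points towards $\varepsilon$ (both endpoints of $\varepsilon$ lie in the component of $T\setminus e$ containing $t_e$) and $-1$ if $e$ points away from $\varepsilon$ (both endpoints lie in the component containing $s_e$). *)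

theory Defs
  imports
    "HOL-Analysis.Convex"
    "HOL-Library.Function_Algebras"
    "HOL-Library.Set_Algebras"
    "HOL-Library.Poly_Mapping"
    "Graph_Theory.Digraph_Component"
begin

text \<open>Function spaces carry the pointwise vector space structure.\<close>

instantiation "fun" :: (type, real_vector) real_vector
begin

definition scaleR_fun_def: "r *\<^sub>R f = (\<lambda>x. r *\<^sub>R f x)"

instance
  by standard
    (simp_all add: scaleR_fun_def fun_eq_iff scaleR_add_right scaleR_add_left)

end

section \<open>Tropical curves and spanning trees\<close>

text \<open>
  A model is a finite multigraph, loops allowed. It is given by a digraph in which every edge
  occurs as exactly one arc, so that an orientation is fixed: \<^const>\<open>tail\<close> is the source and
  \<^const>\<open>head\<close> the target. Connectivity and all walks below ignore the orientation.
\<close>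

definition genus :: "('v, 'e) pre_digraph \<Rightarrow> int" where
  "genus G = int (card (arcs G)) - int (card (verts G)) + 1"

definition tropical_curve :: "('v, 'e) pre_digraph \<Rightarrow> ('e \<Rightarrow> real) \<Rightarrow> bool" where
  "tropical_curve G len \<longleftrightarrow>
     fin_digraph G \<and> Digraph_Component.connected G \<and> (\<forall>e\<in>arcs G. len e > 0) \<and>
     genus G \<ge> 2 \<and>
     (\<forall>e\<in>arcs G. Digraph_Component.connected (pre_digraph.del_arc G e))"

text \<open>A step \<open>(e, d)\<close> of a walk traverses \<open>e\<close> along its orientation iff \<open>d\<close> holds.\<close>

fun uwalk :: "('v, 'e) pre_digraph \<Rightarrow> 'v \<Rightarrow> ('e \<times> bool) list \<Rightarrow> 'v \<Rightarrow> bool" where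
  "uwalk G u [] v \<longleftrightarrow> u \<in> verts G \<and> u = v"
| "uwalk G u ((e, d) # p) v \<longleftrightarrow>
     e \<in> arcs G \<and> u = (if d then tail G e else head G e) \<and>
     uwalk G (if d then head G e else tail G e) p v"

text \<open>
  The tree notion of the session \<open>Graph_Theory\<close> only excludes directed cycles, which is too
  weak here; a spanning tree must not contain any closed trail of the underlying
  undirected graph.
\<close>

definition is_spanning_tree :: "('v, 'e) pre_digraph \<Rightarrow> 'e set \<Rightarrow> bool" where
  "is_spanning_tree G F \<longleftrightarrow>
     F \<subseteq> arcs G \<and> Digraph_Component.connected (G\<lparr>arcs := F\<rparr>) \<and>
     \<not> (\<exists>u p. p \<noteq> [] \<and> distinct (map fst p) \<and> uwalk (G\<lparr>arcs := F\<rparr>) u p u)"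

section \<open>The Jacobian\<close>

definition Omega_Z :: "('v, 'e) pre_digraph \<Rightarrow> ('e \<Rightarrow> real) set" where
  "Omega_Z G = {\<omega>. (\<forall>e. \<omega> e \<in> \<int>) \<and> (\<forall>e. e \<notin> arcs G \<longrightarrow> \<omega> e = 0) \<and>
     (\<forall>v\<in>verts G. (\<Sum>e | e \<in> arcs G \<and> tail G e = v. \<omega> e)
                 = (\<Sum>e | e \<in> arcs G \<and> head G e = v. \<omega> e))}"

definition Omega :: "('v, 'e) pre_digraph \<Rightarrow> ('e \<Rightarrow> real) set" where
  "Omega G = span (Omega_Z G)"

type_synonym 'e covec = "('e \<Rightarrow> real) \<Rightarrow> real"

text \<open>
  A functional on \<open>\<Omega>\<close> is represented by its extension by \<open>0\<close> to all functions, so that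
  equality of representatives is equality on \<open>\<Omega>\<close>.
\<close>

definition on_Omega :: "('v, 'e) pre_digraph \<Rightarrow> 'e covec \<Rightarrow> 'e covec" where
  "on_Omega G \<phi> = (\<lambda>\<omega>. if \<omega> \<in> Omega G then \<phi> \<omega> else 0)"

definition dual :: "('v, 'e) pre_digraph \<Rightarrow> 'e covec set" where
  "dual G = {\<phi>. (\<forall>\<alpha>\<in>Omega G. \<forall>\<beta>\<in>Omega G. \<phi> (\<alpha> + \<beta>) = \<phi> \<alpha> + \<phi> \<beta>) \<and>
     (\<forall>r. \<forall>\<alpha>\<in>Omega G. \<phi> (r *\<^sub>R \<alpha>) = r * \<phi> \<alpha>) \<and>
     (\<forall>\<alpha>. \<alpha> \<notin> Omega G \<longrightarrow> \<phi> \<alpha> = 0)}"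

definition dual_Z :: "('v, 'e) pre_digraph \<Rightarrow> 'e covec set" where
  "dual_Z G = {\<phi> \<in> dual G. \<forall>\<omega>\<in>Omega_Z G. \<phi> \<omega> \<in> \<int>}"

definition H1_Z :: "('v, 'e) pre_digraph \<Rightarrow> ('e \<Rightarrow> real) set" where
  "H1_Z G = {a. (\<forall>e. a e \<in> \<int>) \<and> (\<forall>e. e \<notin> arcs G \<longrightarrow> a e = 0) \<and>
     (\<forall>v\<in>verts G. (\<Sum>e | e \<in> arcs G \<and> head G e = v. a e)
                 - (\<Sum>e | e \<in> arcs G \<and> tail G e = v. a e) = 0)}"

definition chain_integral :: "('v, 'e) pre_digraph \<Rightarrow> ('e \<Rightarrow> real) \<Rightarrow> ('e \<Rightarrow> real) \<Rightarrow> 'e covec" where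
  "chain_integral G len a = on_Omega G (\<lambda>\<omega>. \<Sum>e\<in>arcs G. a e * len e * \<omega> e)"

text \<open>The lattice \<open>H\<^sub>\<int>\<close> in \<open>\<Omega>\<^sup>\<or>\<close>; the Jacobian is the quotient of \<^const>\<open>dual\<close> by it.\<close>

definition lattice :: "('v, 'e) pre_digraph \<Rightarrow> ('e \<Rightarrow> real) \<Rightarrow> 'e covec set" where
  "lattice G len = chain_integral G len ` H1_Z G"

definition bvec :: "('v, 'e) pre_digraph \<Rightarrow> 'e \<Rightarrow> 'e covec" where
  "bvec G e = on_Omega G (\<lambda>\<omega>. \<omega> e)"

section \<open>Exterior powers\<close>

text \<open>
  The \<open>p\<close>-th exterior power of \<open>\<Omega>\<^sup>\<or>\<close> is realised as the space of alternating
  \<open>p\<close>-forms on \<open>\<Omega>\<close>; arguments are passed as a list of length \<open>p\<close>. The normalisation is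
  \<open>(v\<^sub>1 \<and> \<dots> \<and> v\<^sub>p) [\<omega>\<^sub>1, \<dots>, \<omega>\<^sub>p] = det (v\<^sub>i \<omega>\<^sub>j)\<close>, for which the integral exterior power embeds
  as the subgroup generated by wedges of integral vectors. \<open>vwedge v w\<close> is \<open>v \<and> w\<close>
  for a vector \<open>v\<close> (expansion along the first row).
\<close>

type_synonym 'e multivec = "('e \<Rightarrow> real) list \<Rightarrow> real"

definition drop_nth :: "nat \<Rightarrow> 'a list \<Rightarrow> 'a list" where
  "drop_nth i xs = take i xs @ drop (Suc i) xs"

definition vwedge :: "'e covec \<Rightarrow> 'e multivec \<Rightarrow> 'e multivec" where
  "vwedge v w = (\<lambda>\<omega>s. \<Sum>i<length \<omega>s. (-1) ^ i * v (\<omega>s ! i) * w (drop_nth i \<omega>s))"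

definition wedge :: "'e covec list \<Rightarrow> 'e multivec" where
  "wedge vs = foldr vwedge vs (\<lambda>\<omega>s. if \<omega>s = [] then 1 else 0)"

definition ext_power :: "('v, 'e) pre_digraph \<Rightarrow> nat \<Rightarrow> 'e multivec set" where
  "ext_power G p = span {wedge vs | vs. length vs = p \<and> set vs \<subseteq> dual G}"

definition ext_power_Z :: "('v, 'e) pre_digraph \<Rightarrow> nat \<Rightarrow> 'e multivec set" where
  "ext_power_Z G p = module.span (\<lambda>(k::int) w. of_int k *\<^sub>R w)
     {wedge vs | vs. length vs = p \<and> set vs \<subseteq> dual_Z G}"

section \<open>Polyhedral chains on the Jacobian and the monodromy operator\<close>

text \<open>
  The cells are affine simplices, oriented by an ordering of their vertices. A \<open>q\<close>-simplex of
  the Jacobian is the set of all its lifts to \<open>\<Omega>\<^sup>\<or>\<close>, that is, the orbit under the lattice of a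
  list of \<open>q + 1\<close> points; degenerate simplices are allowed. \<^term>\<open>Poly_Mapping.single P v\<close>
  is the chain written \<open>[P, v]\<close>.
\<close>

type_synonym 'e cell = "'e covec list set"
type_synonym 'e chain = "'e cell \<Rightarrow>\<^sub>0 'e multivec"

definition cell :: "('v, 'e) pre_digraph \<Rightarrow> ('e \<Rightarrow> real) \<Rightarrow> 'e covec list \<Rightarrow> 'e cell" where
  "cell G len xs = {map ((+) \<mu>) xs | \<mu>. \<mu> \<in> lattice G len}"

definition jac_simplices :: "('v, 'e) pre_digraph \<Rightarrow> ('e \<Rightarrow> real) \<Rightarrow> nat \<Rightarrow> 'e cell set" where
  "jac_simplices G len q = {cell G len xs | xs. length xs = Suc q \<and> set xs \<subseteq> dual G}"

definition chains_R :: "('v, 'e) pre_digraph \<Rightarrow> ('e \<Rightarrow> real) \<Rightarrow> nat \<Rightarrow> nat \<Rightarrow> 'e chain set" where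
  "chains_R G len p q =
     {c. \<forall>P\<in>Poly_Mapping.keys c. P \<in> jac_simplices G len q \<and> Poly_Mapping.lookup c P \<in> ext_power G p}"

definition chains_Z :: "('v, 'e) pre_digraph \<Rightarrow> ('e \<Rightarrow> real) \<Rightarrow> nat \<Rightarrow> nat \<Rightarrow> 'e chain set" where
  "chains_Z G len p q =
     {c. \<forall>P\<in>Poly_Mapping.keys c. P \<in> jac_simplices G len q \<and> Poly_Mapping.lookup c P \<in> ext_power_Z G p}"

text \<open>
  The image of a cell under \<^term>\<open>drop_nth i\<close> is its facet opposite to the vertex \<open>i\<close>, with
  sign \<open>(-1)\<^sup>i\<close> in the boundary. The argument \<open>q\<close> is the dimension of the chain.
\<close>

definition boundary :: "nat \<Rightarrow> 'e chain \<Rightarrow> 'e chain" where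
  "boundary q c = (if q = 0 then 0 else
     \<Sum>P\<in>Poly_Mapping.keys c. \<Sum>i\<le>q. Poly_Mapping.single (drop_nth i ` P) ((-1) ^ i *\<^sub>R Poly_Mapping.lookup c P))"

text \<open>
  A choice of points \<open>o\<^sub>P \<in> P\<close> is encoded by its lift to the universal cover, an equivariant
  function on lifted simplices. Equivariance makes the differences \<open>o\<^sub>P - o\<^sub>Q\<close> in
  \<open>monodromy\<close> independent of the lift of \<open>P\<close> that is used.
\<close>

definition cell_points ::
  "('v, 'e) pre_digraph \<Rightarrow> ('e \<Rightarrow> real) \<Rightarrow> ('e covec list \<Rightarrow> 'e covec) \<Rightarrow> bool" where
  "cell_points G len pt \<longleftrightarrow> (\<forall>xs. xs \<noteq> [] \<and> set xs \<subseteq> dual G \<longrightarrow>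
     pt xs \<in> convex hull (set xs) \<and> (\<forall>\<mu>\<in>lattice G len. pt (map ((+) \<mu>) xs) = pt xs + \<mu>))"

definition monodromy :: "('e covec list \<Rightarrow> 'e covec) \<Rightarrow> nat \<Rightarrow> 'e chain \<Rightarrow> 'e chain" where
  "monodromy pt q c = (if q = 0 then 0 else
     \<Sum>P\<in>Poly_Mapping.keys c. \<Sum>i\<le>q. let xs = (SOME xs. xs \<in> P) in
       Poly_Mapping.single (drop_nth i ` P)
         ((-1) ^ i *\<^sub>R vwedge (pt xs - pt (drop_nth i xs)) (Poly_Mapping.lookup c P)))"

section \<open>The intermediate Jacobian\<close>

definition bounds21 :: "('v, 'e) pre_digraph \<Rightarrow> ('e \<Rightarrow> real) \<Rightarrow> 'e chain set" where
  "bounds21 G len = boundary 2 ` chains_R G len 2 2"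

text \<open>
  Cycles representing \<open>L\<^sub>2\<^sub>,\<^sub>1 = N (H\<^sub>1\<^sub>,\<^sub>2(Jac, \<int>))\<close>. On integral cycles, different
  choices of points change the value of the monodromy operator by an element of \<open>bounds21\<close>
  only, so \<open>bounds21 + L21\<close> is a subgroup and agrees with the one obtained from any single choice.
\<close>

definition L21 :: "('v, 'e) pre_digraph \<Rightarrow> ('e \<Rightarrow> real) \<Rightarrow> 'e chain set" where
  "L21 G len = {monodromy pt 2 z | pt z.
     cell_points G len pt \<and> z \<in> chains_Z G len 1 2 \<and> boundary 2 z = 0}"

text \<open>
  The class in \<open>JH\<^sub>2\<^sub>,\<^sub>1 = H\<^sub>2\<^sub>,\<^sub>1(Jac, \<real>) / L\<^sub>2\<^sub>,\<^sub>1\<close> of a cycle of type \<open>(2, 1)\<close>; the two successive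
  quotients (by boundaries and by \<open>L\<^sub>2\<^sub>,\<^sub>1\<close>) are taken at once.
\<close>

definition JH_class :: "('v, 'e) pre_digraph \<Rightarrow> ('e \<Rightarrow> real) \<Rightarrow> 'e chain \<Rightarrow> 'e chain set" where
  "JH_class G len c = c +o (bounds21 G len + L21 G len)"

section \<open>The pointed Ceresa class\<close>

text \<open>
  A point of \<open>\<Gamma>\<close> is given by an edge and the distance along it from its source. (Vertices have
  several such descriptions; every vertex has one since there are no isolated vertices.)
\<close>

definition curve_points :: "('v, 'e) pre_digraph \<Rightarrow> ('e \<Rightarrow> real) \<Rightarrow> ('e \<times> real) set" where
  "curve_points G len = {(e, t). e \<in> arcs G \<and> 0 \<le> t \<and> t \<le> len e}"

text \<open>
  Up to homotopy, a path from \<open>(e\<^sub>0, t\<^sub>0)\<close> to \<open>(e, t)\<close> runs back along \<open>e\<^sub>0\<close> to its source, then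
  follows a walk \<open>p\<close> to the source of \<open>e\<close>, and then runs along \<open>e\<close>.
\<close>

fun path_integral ::
  "('v, 'e) pre_digraph \<Rightarrow> ('e \<Rightarrow> real) \<Rightarrow> 'e \<times> real \<Rightarrow> ('e \<times> bool) list \<Rightarrow> 'e \<times> real \<Rightarrow> 'e covec"
where
  "path_integral G len (e\<^sub>0, t\<^sub>0) p (e, t) = on_Omega G (\<lambda>\<omega>.
     - t\<^sub>0 * \<omega> e\<^sub>0 + (\<Sum>(e', d)\<leftarrow>p. (if d then 1 else -1) * len e' * \<omega> e') + t * \<omega> e)"

text \<open>The image in the Jacobian of the oriented edge \<open>e\<close> under \<open>x \<mapsto> I\<^sub>\<gamma>\<close>, \<open>\<gamma>\<close> a path from \<open>b\<close> to \<open>x\<close>.\<close>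

definition aj_edge :: "('v, 'e) pre_digraph \<Rightarrow> ('e \<Rightarrow> real) \<Rightarrow> 'e \<times> real \<Rightarrow> 'e \<Rightarrow> 'e cell" where
  "aj_edge G len b e = {[path_integral G len b p (e, 0), path_integral G len b p (e, len e)] | p.
     uwalk G (tail G (fst b)) p (tail G e)}"

definition aj_edge_minus ::
  "('v, 'e) pre_digraph \<Rightarrow> ('e \<Rightarrow> real) \<Rightarrow> 'e \<times> real \<Rightarrow> 'e \<Rightarrow> 'e cell" where
  "aj_edge_minus G len b e = map uminus ` aj_edge G len b e"

definition primitive :: "('v, 'e) pre_digraph \<Rightarrow> 'e covec \<Rightarrow> bool" where
  "primitive G v \<longleftrightarrow> v \<in> dual_Z G \<and>
     (\<forall>u\<in>dual_Z G. \<forall>k::nat. v = real k *\<^sub>R u \<longrightarrow> k = 1)"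

definition edge_direction :: "('v, 'e) pre_digraph \<Rightarrow> 'e cell \<Rightarrow> 'e covec" where
  "edge_direction G P = (THE v. primitive G v \<and>
     (\<exists>xs\<in>P. \<exists>r>0. xs ! 1 - xs ! 0 = r *\<^sub>R v))"

text \<open>
  The fundamental chain of the tropical 1-cycle whose edges are the cells \<open>P e\<close>, all of
  weight 1.
\<close>

definition fundamental_chain :: "('v, 'e) pre_digraph \<Rightarrow> ('e \<Rightarrow> 'e cell) \<Rightarrow> 'e chain" where
  "fundamental_chain G P =
     (\<Sum>e\<in>arcs G. Poly_Mapping.single (P e) (wedge [edge_direction G (P e)]))"

definition ceresa_chain ::
  "('v, 'e) pre_digraph \<Rightarrow> ('e \<Rightarrow> real) \<Rightarrow> 'e \<times> real \<Rightarrow> 'e chain" where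
  "ceresa_chain G len b =
     fundamental_chain G (aj_edge G len b) - fundamental_chain G (aj_edge_minus G len b)"

definition pointed_ceresa_class ::
  "('v, 'e) pre_digraph \<Rightarrow> ('e \<Rightarrow> real) \<Rightarrow> 'e \<times> real \<Rightarrow> 'e chain set" where
  "pointed_ceresa_class G len b = (THE C. \<exists>pt \<xi>.
     cell_points G len pt \<and> \<xi> \<in> chains_Z G len 1 2 \<and> boundary 2 \<xi> = ceresa_chain G len b \<and>
     C = JH_class G len (monodromy pt 2 \<xi>))"

section \<open>The unpointed Ceresa class\<close>

definition avec :: "('v, 'e) pre_digraph \<Rightarrow> 'e set \<Rightarrow> 'e \<Rightarrow> ('e \<Rightarrow> real)" where
  "avec G F \<epsilon> =
     (THE a. a \<in> H1_Z G \<and> a \<epsilon> = 1 \<and> (\<forall>e. e \<notin> insert \<epsilon> F \<longrightarrow> a e = 0))"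

text \<open>
  \<open>a \<otimes> w\<close> for \<open>a \<in> H\<^sub>\<int>\<close>: under \<open>H\<^sub>p\<^sub>,\<^sub>1(Jac, \<real>) = H \<otimes> \<And>\<^sup>p \<Omega>\<^sup>\<or>\<close> it is the class of the closed
  segment from \<open>0\<close> to the lattice point of \<open>a\<close>, with coefficient \<open>w\<close>.
\<close>

definition tensor ::
  "('v, 'e) pre_digraph \<Rightarrow> ('e \<Rightarrow> real) \<Rightarrow> ('e \<Rightarrow> real) \<Rightarrow> 'e multivec \<Rightarrow> 'e chain" where
  "tensor G len a w = Poly_Mapping.single (cell G len [0, chain_integral G len a]) w"

definition omega_wedge ::
  "('v, 'e) pre_digraph \<Rightarrow> ('e \<Rightarrow> real) \<Rightarrow> 'e set \<Rightarrow> 'e covec \<Rightarrow> 'e chain" where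
  "omega_wedge G len F v = (\<Sum>\<epsilon>\<in>arcs G - F. tensor G len (avec G F \<epsilon>) (wedge [bvec G \<epsilon>, v]))"

text \<open>
  Cycles representing \<open>\<omega> \<and> H\<^sub>1\<^sub>,\<^sub>0(Jac, \<real>)\<close>. The class of \<open>\<omega>\<close> does not depend on the spanning
  tree, so any single tree gives the same classes.
\<close>

definition omega_H10 :: "('v, 'e) pre_digraph \<Rightarrow> ('e \<Rightarrow> real) \<Rightarrow> 'e chain set" where
  "omega_H10 G len = {omega_wedge G len F v | F v. is_spanning_tree G F \<and> v \<in> dual G}"

definition JHbar_class :: "('v, 'e) pre_digraph \<Rightarrow> ('e \<Rightarrow> real) \<Rightarrow> 'e chain \<Rightarrow> 'e chain set" where
  "JHbar_class G len c = c +o (bounds21 G len + L21 G len + omega_H10 G len)"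

text \<open>
  Adding \<^const>\<open>omega_H10\<close> to a coset representing a class in \<open>JH\<^sub>2\<^sub>,\<^sub>1\<close> gives its image in the
  quotient.
\<close>

definition unpointed_ceresa_class ::
  "('v, 'e) pre_digraph \<Rightarrow> ('e \<Rightarrow> real) \<Rightarrow> 'e chain set" where
  "unpointed_ceresa_class G len =
     (THE C. \<exists>b\<in>curve_points G len. C = pointed_ceresa_class G len b + omega_H10 G len)"

definition tree_component :: "('v, 'e) pre_digraph \<Rightarrow> 'e set \<Rightarrow> 'e \<Rightarrow> 'v \<Rightarrow> 'v set" where
  "tree_component G F e u = {v. \<exists>p. uwalk (G\<lparr>arcs := F - {e}\<rparr>) u p v}"

definition tree_sgn :: "('v, 'e) pre_digraph \<Rightarrow> 'e set \<Rightarrow> 'e \<Rightarrow> 'e \<Rightarrow> real" where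
  "tree_sgn G F e \<epsilon> =
     (if avec G F \<epsilon> e \<noteq> 0 then 0
      else if {tail G \<epsilon>, head G \<epsilon>} \<subseteq> tree_component G F e (head G e) then 1
      else if {tail G \<epsilon>, head G \<epsilon>} \<subseteq> tree_component G F e (tail G e) then -1
      else 0)"

end

theory Submission
  imports Defs
begin

text \<open>
  The proof computes with an explicit chain bounded by the Ceresa cycle and a convenient choice of
  points on the cells.

  \<^bold>\<open>Choice of points.\<close> Let every simplex be represented by its first vertex. Then the monodromy
  operator sends \<open>[x\<^sub>0 x\<^sub>1 x\<^sub>2, v]\<close> to \<open>[x\<^sub>1 x\<^sub>2, (x\<^sub>0 - x\<^sub>1) \<and> v]\<close> (lemma \<open>monodromy_hd_triangle\<close>). Any other
  choice gives the same class: the operators of two choices are chain homotopic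
  (\<open>monodromy_homotopy\<close>), and the homotopy vanishes on the Ceresa cycle because there both chosen
  points lie on an edge whose direction is the coefficient (\<open>point_homotopy_parallel\<close>).

  \<^bold>\<open>Lifting the curve.\<close> The tree provides a lift \<open>q v\<close> of every vertex \<open>v\<close> to \<open>\<Omega>\<^sup>\<or>\<close>. An edge \<open>e\<close> then
  lifts to the segment from \<open>q (tail e)\<close> to \<open>q (head e) + \<mu>\<^sub>e\<close>, where \<open>\<mu>\<^sub>e\<close> is the lattice vector of the
  fundamental cycle of \<open>e\<close>, or \<open>0\<close> if \<open>e\<close> belongs to the tree (\<open>position_step\<close>). Coning the edges of
  the curve and of its mirror image from the origin and adding a few triangles that correct for the
  \<open>\<mu>\<^sub>e\<close> gives a chain bounded by the Ceresa cycle: the remaining sides cancel at every vertex, because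
  the vectors \<open>b\<^sub>e\<close> entering and leaving a vertex have the same sum (\<open>sum_arcs_telescope\<close>).

  \<^bold>\<open>Evaluation.\<close> Modulo boundaries, the monodromy operator sends this chain to
  \<open>\<Sum>\<^sub>\<epsilon> a\<^sub>\<epsilon> \<otimes> (b\<^sub>\<epsilon> \<and> (q (tail \<epsilon>) + q (head \<epsilon>)))\<close>, summed over the edges \<open>\<epsilon>\<close> outside the tree,
  again by cancellation at the vertices (\<open>monodromy_ceresa_filling\<close>). The coefficient of
  \<open>\<ell>(e) b\<^sub>e\<close> in \<open>q v\<close> is, up to a constant, \<open>1/2\<close> or \<open>- 1/2\<close> according to the side of the tree edge \<open>e\<close> on
  which \<open>v\<close> lies. So the sum over the two ends of \<open>\<epsilon>\<close> is \<open>\<Sum>\<^sub>e sgn(e, \<epsilon>) \<ell>(e) b\<^sub>e\<close> up to a vector that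
  does not depend on \<open>\<epsilon>\<close>, and such a vector contributes an element of \<open>\<omega> \<and> H\<^sub>1\<^sub>,\<^sub>0\<close>. The class of \<open>\<omega>\<close> is the same for all trees (\<open>omega_wedge_independent\<close>), so that the
  relations divided out form a subgroup (\<open>add_subgroup_total\<close>).
\<close>

section \<open>Walks and their integral chains\<close>

text \<open>
  Walks of the underlying undirected graph are recorded by the integral 1-chain that counts the
  signed passages through each edge. Integration along a walk, and membership of a difference
  of walks in \<open>H\<^sub>\<int>\<close>, depend on this chain only.
\<close>

fun walk_chain :: "('e \<times> bool) list \<Rightarrow> 'e \<Rightarrow> real" where
  "walk_chain [] = 0"
| "walk_chain ((e, d) # p) = (\<lambda>x. if x = e then (if d then 1 else -1) else 0) + walk_chain p"

definition rev_walk :: "('e \<times> bool) list \<Rightarrow> ('e \<times> bool) list" where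
  "rev_walk p = rev (map (\<lambda>(e, d). (e, \<not> d)) p)"

definition divergence :: "('v, 'e) pre_digraph \<Rightarrow> ('e \<Rightarrow> real) \<Rightarrow> 'v \<Rightarrow> real" where
  "divergence G a v =
     (\<Sum>e | e \<in> arcs G \<and> head G e = v. a e) - (\<Sum>e | e \<in> arcs G \<and> tail G e = v. a e)"

lemma walk_chain_append: "walk_chain (p @ q) = walk_chain p + walk_chain q"
  by (induction p rule: walk_chain.induct) (simp_all add: add.assoc)

lemma walk_chain_rev_walk: "walk_chain (rev_walk p) = - walk_chain p"
  by (induction p rule: walk_chain.induct)
    (auto simp: rev_walk_def walk_chain_append fun_eq_iff)

lemma walk_chain_Ints: "walk_chain p e \<in> \<int>"
  by (induction p rule: walk_chain.induct) auto

lemma walk_chain_outside: "e \<notin> fst ` set p \<Longrightarrow> walk_chain p e = 0"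
  by (induction p rule: walk_chain.induct) auto

lemma uwalk_verts: "wf_digraph G \<Longrightarrow> uwalk G u p v \<Longrightarrow> u \<in> verts G \<and> v \<in> verts G"
  by (induction G u p v rule: uwalk.induct)
    (auto simp: wf_digraph.tail_in_verts wf_digraph.head_in_verts)

lemma uwalk_arcs: "uwalk G u p v \<Longrightarrow> fst ` set p \<subseteq> arcs G"
  by (induction G u p v rule: uwalk.induct) auto

lemma uwalk_append:
  "wf_digraph G \<Longrightarrow> uwalk G u (p @ q) w \<longleftrightarrow> (\<exists>v. uwalk G u p v \<and> uwalk G v q w)"
proof (induction p arbitrary: u)
  case Nil
  then show ?case by (auto dest: uwalk_verts)
next
  case (Cons ed p)
  then show ?case by (cases ed) auto
qed

lemma uwalk_Cons_single:
  "wf_digraph G \<Longrightarrow> uwalk G u [(e, d)] v \<longleftrightarrow>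
    e \<in> arcs G \<and> u = (if d then tail G e else head G e) \<and> v = (if d then head G e else tail G e)"
  by (auto simp: wf_digraph.tail_in_verts wf_digraph.head_in_verts)

lemma uwalk_rev_walk: "wf_digraph G \<Longrightarrow> uwalk G u p v \<Longrightarrow> uwalk G v (rev_walk p) u"
proof (induction p arbitrary: u)
  case Nil
  then show ?case by (auto simp: rev_walk_def)
next
  case (Cons ed p)
  obtain e d where ed: "ed = (e, d)" by fastforce
  let ?w = "if d then head G e else tail G e"
  have "uwalk G v (rev_walk p) ?w" "e \<in> arcs G" "u = (if d then tail G e else head G e)"
    using Cons ed by auto
  moreover have "rev_walk (ed # p) = rev_walk p @ [(e, \<not> d)]"
    by (simp add: rev_walk_def ed)
  ultimately show ?case
    using Cons.prems(1) by (auto simp: uwalk_append uwalk_Cons_single simp del: uwalk.simps)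
qed

lemma uwalk_mono:
  assumes "uwalk (G\<lparr>arcs := A\<rparr>) u p v" "A \<subseteq> B"
  shows "uwalk (G\<lparr>arcs := B\<rparr>) u p v"
  using assms by (induction p arbitrary: u) auto

lemma wf_digraph_arcs_update: "wf_digraph G \<Longrightarrow> A \<subseteq> arcs G \<Longrightarrow> wf_digraph (G\<lparr>arcs := A\<rparr>)"
  by (auto simp: wf_digraph_def)

lemma connected_imp_uwalk:
  assumes "wf_digraph G" "Digraph_Component.connected G" "u \<in> verts G" "v \<in> verts G"
  shows "\<exists>p. uwalk G u p v"
proof -
  have "(u, v) \<in> rtrancl_on (verts G) (parcs (mk_symmetric G))"
    using assms unfolding Digraph_Component.connected_def strongly_connected_def reachable_def
    by (auto simp: arcs_ends_def arc_to_ends_def)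
  then show ?thesis
  proof (induction rule: rtrancl_on_induct)
    case base
    then have "uwalk G u [] u" by simp
    then show ?case by blast
  next
    case (step y z)
    then obtain p where p: "uwalk G u p y" by blast
    from step(2) obtain e where
      "e \<in> arcs G" "(y, z) = (tail G e, head G e) \<or> (y, z) = (head G e, tail G e)"
      by (auto simp: parcs_mk_symmetric)
    then have "\<exists>d. uwalk G y [(e, d)] z"
      using assms(1) by (auto simp: uwalk_Cons_single simp del: uwalk.simps)
    then show ?case using p uwalk_append[OF assms(1)] by blast
  qed
qed

text \<open>
  A shortest walk is a trail: between two passages through the same edge the walk can be cut
  short, keeping one passage if both go in the same direction and none otherwise.
\<close>

lemma uwalk_imp_trail:
  assumes wf: "wf_digraph G" and "uwalk G u p v"
  shows "\<exists>q. uwalk G u q v \<and> distinct (map fst q)"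
  using assms(2)
proof (induction p rule: length_induct)
  case (1 p)
  show ?case
  proof (cases "distinct (map fst p)")
    case True
    then show ?thesis using 1 by blast
  next
    case False
    then obtain xs ys zs e where "map fst p = xs @ [e] @ ys @ [e] @ zs"
      using not_distinct_decomp by blast
    then have "map fst p = xs @ e # ys @ e # zs" by simp
    then obtain p1 p' where "p = p1 @ p'" "map fst p' = e # ys @ e # zs"
      unfolding map_eq_append_conv by metis
    moreover from this(2) obtain x q where "p' = x # q" "fst x = e" "map fst q = ys @ e # zs"
      unfolding map_eq_Cons_conv by metis
    moreover from this(3) obtain p2 q' where "q = p2 @ q'" "map fst q' = e # zs"
      unfolding map_eq_append_conv by metis
    moreover from this(2) obtain y p3 where "q' = y # p3" "fst y = e"
      unfolding map_eq_Cons_conv by metis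
    ultimately obtain d1 d2 where p: "p = p1 @ (e, d1) # p2 @ (e, d2) # p3"
      by (cases x; cases y) auto
    have "\<exists>q. length q < length p \<and> uwalk G u q v"
    proof (cases "d1 = d2")
      case True
      then have "uwalk G u (p1 @ (e, d2) # p3) v"
        using "1.prems" by (auto simp: p uwalk_append[OF wf])
      then show ?thesis by (intro exI[of _ "p1 @ (e, d2) # p3"]) (simp add: p)
    next
      case False
      then have "uwalk G u (p1 @ p3) v"
        using "1.prems" by (cases d1) (auto simp: p uwalk_append[OF wf])
      then show ?thesis by (intro exI[of _ "p1 @ p3"]) (simp add: p)
    qed
    then show ?thesis using 1 by blast
  qed
qed

lemma divergence_add: "divergence G (a + b) v = divergence G a v + divergence G b v"
  by (simp add: divergence_def sum.distrib)

lemma divergence_scaleR: "divergence G (r *\<^sub>R a) v = r * divergence G a v"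
  by (simp add: divergence_def scaleR_fun_def sum_distrib_left right_diff_distrib)

lemma divergence_diff: "divergence G (a - b) v = divergence G a v - divergence G b v"
  by (simp add: divergence_def sum_subtractf)

lemma divergence_zero [simp]: "divergence G 0 v = 0"
  by (simp add: divergence_def)

lemma divergence_arc:
  assumes "fin_digraph G" "e \<in> arcs G"
  shows "divergence G (\<lambda>x. if x = e then c else 0) v =
    (if head G e = v then c else 0) - (if tail G e = v then c else 0)"
proof -
  have "finite {e \<in> arcs G. P e}" for P using assms(1) by (simp add: fin_digraph.finite_arcs)
  then show ?thesis using assms(2) by (simp add: divergence_def sum.delta)
qed

lemma divergence_walk_chain:
  assumes "fin_digraph G" "uwalk G u p v"
  shows "divergence G (walk_chain p) w = (if w = v then 1 else 0) - (if w = u then 1 else 0)"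
  using assms(2)
proof (induction p arbitrary: u)
  case Nil
  then show ?case unfolding walk_chain.simps divergence_zero by simp
next
  case (Cons ed p)
  obtain e d where ed: "ed = (e, d)" by fastforce
  have "divergence G (walk_chain p) w =
      (if w = v then 1 else 0) - (if w = (if d then head G e else tail G e) then 1 else 0)"
    using Cons by (simp add: ed)
  then show ?case
    using Cons.prems unfolding ed walk_chain.simps divergence_add
    by (cases d) (auto simp: divergence_arc[OF assms(1)])
qed

lemma H1_Z_iff:
  "a \<in> H1_Z G \<longleftrightarrow> (\<forall>e. a e \<in> \<int>) \<and> (\<forall>e. e \<notin> arcs G \<longrightarrow> a e = 0) \<and> (\<forall>v\<in>verts G. divergence G a v = 0)"
  by (simp add: H1_Z_def divergence_def)

lemma Omega_Z_eq_H1_Z: "Omega_Z G = H1_Z G"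
  by (auto simp: Omega_Z_def H1_Z_def)

lemma H1_Z_0 [simp]: "0 \<in> H1_Z G"
  by (simp add: H1_Z_iff)

lemma H1_Z_add: "a \<in> H1_Z G \<Longrightarrow> b \<in> H1_Z G \<Longrightarrow> a + b \<in> H1_Z G"
  by (simp add: H1_Z_iff divergence_add)

lemma H1_Z_scale: "a \<in> H1_Z G \<Longrightarrow> k \<in> \<int> \<Longrightarrow> k *\<^sub>R a \<in> H1_Z G"
  using divergence_scaleR[of G k a] by (simp add: H1_Z_iff scaleR_fun_def)

lemma H1_Z_uminus: "a \<in> H1_Z G \<Longrightarrow> - a \<in> H1_Z G"
  using H1_Z_scale[of a G "-1"] by simp

lemma H1_Z_diff: "a \<in> H1_Z G \<Longrightarrow> b \<in> H1_Z G \<Longrightarrow> a - b \<in> H1_Z G"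
  using H1_Z_add[of a G "- b"] by (simp add: H1_Z_uminus)

lemma H1_Z_sum: "(\<And>i. i \<in> I \<Longrightarrow> a i \<in> H1_Z G) \<Longrightarrow> (\<Sum>i\<in>I. a i) \<in> H1_Z G"
  by (induction I rule: infinite_finite_induct) (simp_all add: H1_Z_add)

lemma closed_walk_chain_H1_Z:
  assumes "fin_digraph G" "uwalk G u p v" "uwalk G u q v"
  shows "walk_chain p - walk_chain q \<in> H1_Z G"
proof -
  have "divergence G (walk_chain p - walk_chain q) w = 0" for w
    using divergence_walk_chain[OF assms(1,2)] divergence_walk_chain[OF assms(1,3)]
    by (simp add: divergence_diff)
  moreover have "walk_chain p e = 0 \<and> walk_chain q e = 0" if "e \<notin> arcs G" for e
    using assms(2,3) that by (auto dest!: uwalk_arcs intro!: walk_chain_outside)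
  ultimately show ?thesis
    by (simp add: H1_Z_iff walk_chain_Ints)
qed

section \<open>Functionals on harmonic forms\<close>

lemma sum_fun_apply: "(\<Sum>i\<in>I. f i) x = (\<Sum>i\<in>I. f i x)"
  by (induction I rule: infinite_finite_induct) simp_all

lemma scaleR_fun_apply [simp]: "(r *\<^sub>R f) x = r *\<^sub>R f x"
  by (simp add: scaleR_fun_def)

lemma subspace_dual: "subspace (dual G)"
  by (rule subspaceI) (auto simp: dual_def algebra_simps)

lemmas dual_0 [simp] = subspace_0[OF subspace_dual]
lemmas dual_add = subspace_add[OF subspace_dual]
lemmas dual_diff = subspace_diff[OF subspace_dual]
lemmas dual_scale = subspace_scale[OF subspace_dual]
lemmas dual_uminus = subspace_neg[OF subspace_dual]
lemmas dual_sum = subspace_sum[OF subspace_dual]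

lemma Omega_Z_subset_Omega: "Omega_Z G \<subseteq> Omega G"
  unfolding Omega_def by (rule span_superset)

lemma subspace_Omega: "subspace (Omega G)"
  unfolding Omega_def by (rule subspace_span)

text \<open>
  Outside \<open>\<Omega>\<close> all functionals vanish by convention, and \<open>\<Omega>\<close> is spanned by the integral forms.
  Relations between the vectors \<open>b\<^sub>e\<close> can therefore be checked on integral harmonic forms.
\<close>

lemma dual_eqI:
  assumes "\<phi> \<in> dual G" "\<psi> \<in> dual G" "\<And>\<omega>. \<omega> \<in> Omega_Z G \<Longrightarrow> \<phi> \<omega> = \<psi> \<omega>"
  shows "\<phi> = \<psi>"
proof
  fix \<omega>
  let ?S = "{\<omega> \<in> Omega G. \<phi> \<omega> = \<psi> \<omega>}"
  have zero: "\<phi> 0 = 0" "\<psi> 0 = 0"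
    using assms(1,2) subspace_0[OF subspace_Omega, of G] unfolding dual_def
    by (metis (mono_tags, lifting) mem_Collect_eq mult_zero_left scaleR_zero_left)+
  have "subspace ?S"
    using assms(1,2) zero subspace_Omega[of G]
    by (auto intro!: subspaceI simp: dual_def subspace_0 subspace_add subspace_scale)
  moreover have "Omega_Z G \<subseteq> ?S" using assms(3) Omega_Z_subset_Omega by blast
  ultimately have "Omega G \<subseteq> ?S" unfolding Omega_def by (rule span_minimal[rotated])
  then show "\<phi> \<omega> = \<psi> \<omega>"
    using assms(1,2) by (cases "\<omega> \<in> Omega G") (auto simp: dual_def)
qed

lemma bvec_apply: "\<omega> \<in> Omega_Z G \<Longrightarrow> bvec G e \<omega> = \<omega> e"
  using Omega_Z_subset_Omega by (auto simp: bvec_def on_Omega_def)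

lemma bvec_in_dual: "bvec G e \<in> dual G"
  using subspace_Omega[of G]
  by (auto simp: bvec_def on_Omega_def dual_def subspace_add subspace_scale)

lemma bvec_in_dual_Z: "bvec G e \<in> dual_Z G"
  by (auto simp: dual_Z_def bvec_in_dual bvec_apply) (auto simp: Omega_Z_def)

lemma chain_integral_eq: "chain_integral G len a = (\<Sum>e\<in>arcs G. (a e * len e) *\<^sub>R bvec G e)"
  by (auto simp: fun_eq_iff chain_integral_def bvec_def on_Omega_def sum_fun_apply)

lemma chain_integral_in_dual: "chain_integral G len a \<in> dual G"
  by (simp add: chain_integral_eq dual_sum dual_scale bvec_in_dual)

lemma chain_integral_add:
  "chain_integral G len (a + b) = chain_integral G len a + chain_integral G len b"
  by (simp add: chain_integral_eq distrib_right scaleR_left_distrib sum.distrib)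

lemma chain_integral_uminus: "chain_integral G len (- a) = - chain_integral G len a"
  by (simp add: chain_integral_eq sum_negf)

lemma chain_integral_diff:
  "chain_integral G len (a - b) = chain_integral G len a - chain_integral G len b"
  by (simp add: chain_integral_eq left_diff_distrib scaleR_left_diff_distrib sum_subtractf)

lemma chain_integral_0 [simp]: "chain_integral G len 0 = 0"
  by (simp add: chain_integral_eq)

lemma lattice_in_dual: "\<mu> \<in> lattice G len \<Longrightarrow> \<mu> \<in> dual G"
  by (auto simp: lattice_def chain_integral_in_dual)

lemma lattice_0 [simp]: "0 \<in> lattice G len"
  unfolding lattice_def by (rule image_eqI[of _ _ 0]) simp_all

lemma lattice_add: "\<mu> \<in> lattice G len \<Longrightarrow> \<nu> \<in> lattice G len \<Longrightarrow> \<mu> + \<nu> \<in> lattice G len"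
  unfolding lattice_def by (auto simp flip: chain_integral_add intro: H1_Z_add)

lemma lattice_uminus: "\<mu> \<in> lattice G len \<Longrightarrow> - \<mu> \<in> lattice G len"
  unfolding lattice_def by (auto simp flip: chain_integral_uminus intro: H1_Z_uminus)

lemma lattice_diff: "\<mu> \<in> lattice G len \<Longrightarrow> \<nu> \<in> lattice G len \<Longrightarrow> \<mu> - \<nu> \<in> lattice G len"
  using lattice_add[of \<mu> G len "- \<nu>"] by (simp add: lattice_uminus)

section \<open>Graphs without separating edges\<close>

locale tropical_model =
  fixes G :: "('v, 'e) pre_digraph" and len :: "'e \<Rightarrow> real"
  assumes tropical: "tropical_curve G len"
begin

lemma fin_digraph: "fin_digraph G"
  using tropical by (simp add: tropical_curve_def)

lemma wf: "wf_digraph G"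
  using fin_digraph by (simp add: fin_digraph_def)

lemma finite_arcs [simp]: "finite (arcs G)" and finite_verts [simp]: "finite (verts G)"
  using fin_digraph by (simp_all add: fin_digraph.finite_arcs fin_digraph.finite_verts)

lemma ends_in_verts [simp]:
  "e \<in> arcs G \<Longrightarrow> tail G e \<in> verts G" "e \<in> arcs G \<Longrightarrow> head G e \<in> verts G"
  using wf by (simp_all add: wf_digraph_def)

lemma len_pos: "e \<in> arcs G \<Longrightarrow> len e > 0"
  using tropical by (simp add: tropical_curve_def)

lemma uwalk_exists: "u \<in> verts G \<Longrightarrow> v \<in> verts G \<Longrightarrow> \<exists>p. uwalk G u p v"
  using connected_imp_uwalk[OF wf] tropical by (simp add: tropical_curve_def)

text \<open>
  Since an edge is not separating, it closes up to a cycle with a walk that avoids it. The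
  resulting form takes the value \<open>1\<close> on \<open>b\<^sub>e\<close>, which makes \<open>b\<^sub>e\<close> primitive.
\<close>

lemma harmonic_form_through_arc:
  assumes "e \<in> arcs G"
  shows "\<exists>\<omega>\<in>Omega_Z G. \<omega> e = 1"
proof -
  let ?H = "pre_digraph.del_arc G e"
  have wfH: "wf_digraph ?H"
    using wf by (auto simp: wf_digraph_def pre_digraph.del_arc_simps)
  have "Digraph_Component.connected ?H" using tropical assms by (simp add: tropical_curve_def)
  then obtain p where p: "uwalk ?H (tail G e) p (head G e)"
    using connected_imp_uwalk[OF wfH] assms by (metis ends_in_verts pre_digraph.verts_del_arc)
  have "uwalk ?H u q v \<Longrightarrow> uwalk G u q v" for u q v
    by (induction q arbitrary: u) (auto simp: pre_digraph.del_arc_simps)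
  then have "uwalk G (tail G e) p (head G e)" using p by blast
  moreover have "uwalk G (tail G e) [(e, True)] (head G e)" using assms by simp
  ultimately have "walk_chain [(e, True)] - walk_chain p \<in> H1_Z G"
    using closed_walk_chain_H1_Z[OF fin_digraph] by blast
  moreover have "walk_chain p e = 0"
    using uwalk_arcs[OF p] by (intro walk_chain_outside) (auto simp: pre_digraph.del_arc_simps)
  ultimately show ?thesis
    by (intro bexI[of _ "walk_chain [(e, True)] - walk_chain p"]) (simp_all add: Omega_Z_eq_H1_Z)
qed

text \<open>
  Summation by parts: the divergence is adjoint to the coboundary of functions on vertices.
  Cycles are thus orthogonal to coboundaries.
\<close>

lemma sum_divergence:
  "(\<Sum>v\<in>verts G. s v * divergence G a v) = (\<Sum>e\<in>arcs G. a e * (s (head G e) - s (tail G e)))"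
proof -
  have "(\<Sum>v\<in>verts G. s v * (\<Sum>e | e \<in> arcs G \<and> f e = v. a e)) = (\<Sum>e\<in>arcs G. a e * s (f e))"
    if "\<And>e. e \<in> arcs G \<Longrightarrow> f e \<in> verts G" for f
  proof -
    have "(\<Sum>v\<in>verts G. s v * (\<Sum>e | e \<in> arcs G \<and> f e = v. a e))
        = (\<Sum>v\<in>verts G. \<Sum>e | e \<in> arcs G \<and> f e = v. a e * s (f e))"
      by (simp add: sum_distrib_left mult.commute)
    also have "\<dots> = (\<Sum>e\<in>arcs G. a e * s (f e))"
      using that by (intro sum.group) auto
    finally show ?thesis .
  qed
  from this[of "head G"] this[of "tail G"] show ?thesis
    by (simp add: divergence_def right_diff_distrib sum_subtractf)
qed

text \<open>
  At every vertex the incoming and the outgoing vectors \<open>b\<^sub>e\<close> have the same sum, because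
  \<open>\<Omega>\<close> consists of forms that are balanced there.
\<close>

lemma sum_arcs_telescope:
  fixes f :: "'v \<Rightarrow> 'e covec \<Rightarrow> 'a::ab_group_add"
  assumes add: "\<And>v x y. f v (x + y) = f v x + f v y"
  shows "(\<Sum>e\<in>arcs G. f (tail G e) (bvec G e) - f (head G e) (bvec G e)) = 0"
proof -
  have f0: "f v 0 = 0" for v using add[of v 0 0] by simp
  have f_sum: "(\<Sum>i\<in>I. f v (x i)) = f v (\<Sum>i\<in>I. x i)" for v I and x :: "'e \<Rightarrow> 'e covec"
    using sum_comp_morphism[of "f v" x I] by (simp add: add f0 o_def)
  have group: "(\<Sum>e\<in>arcs G. f (h e) (bvec G e)) = (\<Sum>v\<in>verts G. f v (\<Sum>e | e \<in> arcs G \<and> h e = v. bvec G e))"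
    if "\<And>e. e \<in> arcs G \<Longrightarrow> h e \<in> verts G" for h
  proof -
    have "(\<Sum>e\<in>arcs G. f (h e) (bvec G e)) = (\<Sum>v\<in>verts G. \<Sum>e | e \<in> arcs G \<and> h e = v. f (h e) (bvec G e))"
      using that by (intro sum.group[symmetric]) auto
    also have "\<dots> = (\<Sum>v\<in>verts G. f v (\<Sum>e | e \<in> arcs G \<and> h e = v. bvec G e))"
      by (simp flip: f_sum)
    finally show ?thesis .
  qed
  have "(\<Sum>e | e \<in> arcs G \<and> tail G e = v. bvec G e) = (\<Sum>e | e \<in> arcs G \<and> head G e = v. bvec G e)"
    if "v \<in> verts G" for v
    using that
    by (intro dual_eqI[of _ G] dual_sum bvec_in_dual)
      (auto simp: sum_fun_apply bvec_apply, simp add: Omega_Z_def)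
  then show ?thesis by (simp add: sum_subtractf group)
qed

text \<open>
  With walks \<open>\<gamma> v\<close> from \<open>u\<close> to every vertex \<open>v\<close>, an integral cycle \<open>a\<close> is the sum of the chains
  of the closed walks \<open>\<gamma> (tail e), e, - \<gamma> (head e)\<close>, taken \<open>a e\<close> times: the parts in \<open>\<gamma>\<close> cancel.
  Consequently the lifts of a point of the curve, which are indexed by walks, form a full orbit
  of the lattice.
\<close>

lemma H1_Z_closed_walk:
  assumes "u \<in> verts G" "a \<in> H1_Z G"
  shows "\<exists>p. uwalk G u p u \<and> walk_chain p = a"
proof -
  let ?S = "{walk_chain p | p. uwalk G u p u}"
  have zero: "0 \<in> ?S" using assms(1) by (auto intro!: exI[of _ "[]"])
  have add: "x + y \<in> ?S" if xy: "x \<in> ?S" "y \<in> ?S" for x y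
  proof -
    obtain p q where "x = walk_chain p" "y = walk_chain q" "uwalk G u p u" "uwalk G u q u"
      using xy by blast
    then have "x + y = walk_chain (p @ q)" "uwalk G u (p @ q) u"
      by (auto simp: walk_chain_append uwalk_append[OF wf])
    then show ?thesis by blast
  qed
  have neg: "- x \<in> ?S" if "x \<in> ?S" for x
    using that uwalk_rev_walk[OF wf] by (auto simp flip: walk_chain_rev_walk)
  have nat_scale: "real n *\<^sub>R x \<in> ?S" if "x \<in> ?S" for n x
  proof (induction n)
    case 0
    then show ?case using zero by (simp only: of_nat_0 scaleR_zero_left)
  next
    case (Suc n)
    have "real (Suc n) *\<^sub>R x = x + real n *\<^sub>R x" by (simp add: scaleR_left_distrib)
    then show ?case using add[OF that Suc] by (simp only:)
  qed
  have scale: "k *\<^sub>R x \<in> ?S" if "x \<in> ?S" "k \<in> \<int>" for k x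
  proof -
    obtain z where z: "k = of_int z" using \<open>k \<in> \<int>\<close> by (elim Ints_cases)
    show ?thesis
    proof (cases "z \<ge> 0")
      case True
      then have "k = real (nat z)" by (simp add: z)
      then show ?thesis using nat_scale[OF that(1)] by simp
    next
      case False
      then have "k *\<^sub>R x = - (real (nat (- z)) *\<^sub>R x)" by (simp add: z)
      then show ?thesis using neg[OF nat_scale[OF that(1)]] by simp
    qed
  qed
  have sum: "(\<Sum>i\<in>I. x i) \<in> ?S" if "\<And>i. i \<in> I \<Longrightarrow> x i \<in> ?S" for I and x :: "'e \<Rightarrow> 'e \<Rightarrow> real"
    using that by (induction I rule: infinite_finite_induct) (simp_all only: sum.infinite sum.empty sum.insert zero add insertI1 insertI2 not_False_eq_True)
  obtain \<gamma> where \<gamma>: "\<And>v. v \<in> verts G \<Longrightarrow> uwalk G u (\<gamma> v) v"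
    using uwalk_exists[OF assms(1)] by metis
  define c where "c e = walk_chain (\<gamma> (tail G e)) + walk_chain [(e, True)] - walk_chain (\<gamma> (head G e))" for e
  have "c e \<in> ?S" if "e \<in> arcs G" for e
  proof -
    have "uwalk G (tail G e) [(e, True)] (head G e)" using that by simp
    then have "uwalk G u (\<gamma> (tail G e) @ [(e, True)] @ rev_walk (\<gamma> (head G e))) u"
      using uwalk_append[OF wf] uwalk_rev_walk[OF wf] \<gamma> that by (metis ends_in_verts)
    then show ?thesis
      unfolding c_def diff_conv_add_uminus add.assoc
      by (simp only: flip: walk_chain_append walk_chain_rev_walk) blast
  qed
  then have "(\<Sum>e\<in>arcs G. a e *\<^sub>R c e) \<in> ?S"
    using assms(2) by (intro sum scale) (auto simp: H1_Z_iff)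
  moreover have "(\<Sum>e\<in>arcs G. a e *\<^sub>R c e) = a"
  proof
    fix x
    have "(\<Sum>e\<in>arcs G. a e *\<^sub>R c e) x = (\<Sum>e\<in>arcs G. if e = x then a e else 0)
        - (\<Sum>e\<in>arcs G. a e * (walk_chain (\<gamma> (head G e)) x - walk_chain (\<gamma> (tail G e)) x))"
      unfolding sum_fun_apply sum_subtractf[symmetric]
      by (intro sum.cong) (auto simp: c_def algebra_simps)
    also have "(\<Sum>e\<in>arcs G. a e * (walk_chain (\<gamma> (head G e)) x - walk_chain (\<gamma> (tail G e)) x)) = 0"
      using sum_divergence[of "\<lambda>v. walk_chain (\<gamma> v) x" a] assms(2) by (simp add: H1_Z_iff)
    also have "(\<Sum>e\<in>arcs G. if e = x then a e else 0) - 0 = a x"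
      using assms(2) by (simp add: H1_Z_iff sum.delta)
    finally show "(\<Sum>e\<in>arcs G. a e *\<^sub>R c e) x = a x" .
  qed
  ultimately show ?thesis by auto
qed

end

section \<open>Spanning trees and fundamental cycles\<close>

locale spanning_tree_model = tropical_model G len
  for G :: "('v, 'e) pre_digraph" and len :: "'e \<Rightarrow> real" +
  fixes F :: "'e set"
  assumes tree: "is_spanning_tree G F"
begin

lemma F_subset: "F \<subseteq> arcs G"
  using tree by (simp add: is_spanning_tree_def)

lemma finite_F [simp]: "finite F"
  using F_subset finite_arcs finite_subset by blast

lemma wf_tree: "A \<subseteq> F \<Longrightarrow> wf_digraph (G\<lparr>arcs := A\<rparr>)"
  using F_subset wf by (intro wf_digraph_arcs_update) auto

lemma tree_walk_exists: "u \<in> verts G \<Longrightarrow> v \<in> verts G \<Longrightarrow> \<exists>p. uwalk (G\<lparr>arcs := F\<rparr>) u p v"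
  using connected_imp_uwalk[OF wf_tree[OF order_refl]] tree by (simp add: is_spanning_tree_def)

lemma tree_walk_imp_walk: "uwalk (G\<lparr>arcs := F\<rparr>) u p v \<Longrightarrow> uwalk G u p v"
  using uwalk_mono[where B = "arcs G" and G = G] F_subset by fastforce

text \<open>
  The two ends of a tree edge lie in different components once the edge is removed: otherwise
  a trail between them in the rest of the tree would close up to a closed trail.
\<close>

lemma tree_edge_cut:
  assumes "e \<in> F"
  shows "tail G e \<notin> tree_component G F e (head G e)"
proof
  assume "tail G e \<in> tree_component G F e (head G e)"
  then obtain q where q: "uwalk (G\<lparr>arcs := F - {e}\<rparr>) (head G e) q (tail G e)" "distinct (map fst q)"
    using uwalk_imp_trail[OF wf_tree[of "F - {e}"]] unfolding tree_component_def by blast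
  have "uwalk (G\<lparr>arcs := F\<rparr>) (tail G e) ((e, True) # q) (tail G e)"
    using uwalk_mono[OF q(1)] assms by auto
  moreover have "distinct (map fst ((e, True) # q))"
    using q uwalk_arcs[OF q(1)] by auto
  ultimately show False
    using tree unfolding is_spanning_tree_def by blast
qed

text \<open>
  \<open>side e\<close> is the locally constant function on the tree minus \<open>e\<close> with value \<open>1\<close> on the side of
  the head of \<open>e\<close>. On the tree, its coboundary is twice the indicator of \<open>e\<close>. Hence half its
  increment along a tree walk counts the signed passages through \<open>e\<close>.
\<close>

definition side :: "'e \<Rightarrow> 'v \<Rightarrow> real" where
  "side e v = (if v \<in> tree_component G F e (head G e) then 1 else - 1)"

lemma side_ends: "e \<in> F \<Longrightarrow> side e (head G e) = 1" "e \<in> F \<Longrightarrow> side e (tail G e) = - 1"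
  using tree_edge_cut F_subset
  by (auto simp: side_def tree_component_def intro!: exI[of _ "[]"])

lemma side_other_edge:
  assumes "e \<in> F" "e' \<in> F" "e' \<noteq> e"
  shows "side e (head G e') = side e (tail G e')"
proof -
  let ?H = "G\<lparr>arcs := F - {e}\<rparr>"
  have wfH: "wf_digraph ?H" by (rule wf_tree) auto
  have fw: "uwalk ?H (tail G e') [(e', True)] (head G e')"
    and bw: "uwalk ?H (head G e') [(e', False)] (tail G e')"
    using assms F_subset by auto
  have "uwalk ?H u p (tail G e') \<Longrightarrow> \<exists>p. uwalk ?H u p (head G e')" for u p
    using fw uwalk_append[OF wfH] by blast
  moreover have "uwalk ?H u p (head G e') \<Longrightarrow> \<exists>p. uwalk ?H u p (tail G e')" for u p
    using bw uwalk_append[OF wfH] by blast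
  ultimately have "tail G e' \<in> tree_component G F e (head G e) \<longleftrightarrow>
      head G e' \<in> tree_component G F e (head G e)"
    unfolding tree_component_def by blast
  then show ?thesis by (simp add: side_def)
qed

lemma side_coboundary:
  "e \<in> F \<Longrightarrow> e' \<in> F \<Longrightarrow> side e (head G e') - side e (tail G e') = (if e' = e then 2 else 0)"
  by (auto simp: side_ends side_other_edge)

lemma tree_walk_chain:
  assumes "uwalk (G\<lparr>arcs := F\<rparr>) u p v" "e \<in> F"
  shows "walk_chain p e = (side e v - side e u) / 2"
  using assms(1)
proof (induction p arbitrary: u)
  case Nil
  then show ?case by simp
next
  case (Cons ed p)
  obtain e' d where ed: "ed = (e', d)" by fastforce
  show ?case
    using Cons.IH[of "if d then head G e' else tail G e'"] Cons.prems
      side_coboundary[OF assms(2), of e']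
    by (cases d) (auto simp: ed field_simps split: if_splits)
qed

lemma tree_walk_chain_outside:
  "uwalk (G\<lparr>arcs := F\<rparr>) u p v \<Longrightarrow> e \<notin> F \<Longrightarrow> walk_chain p e = 0"
  by (intro walk_chain_outside) (auto dest!: uwalk_arcs)

text \<open>
  The value \<open>- 1\<close> stands for the component of the tail: every vertex is joined in the tree to
  the head of \<open>e\<close>, and a walk that reaches the head only through \<open>e\<close> meets the tail first.
\<close>

lemma side_tail_component:
  assumes "e \<in> F" "v \<in> verts G"
  shows "side e v = - 1 \<longleftrightarrow> v \<in> tree_component G F e (tail G e)"
proof -
  let ?H = "G\<lparr>arcs := F - {e}\<rparr>"
  have wfH: "wf_digraph ?H" by (rule wf_tree) auto
  have union: "v \<in> tree_component G F e (head G e) \<or> v \<in> tree_component G F e (tail G e)"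
  proof -
    obtain p where "uwalk (G\<lparr>arcs := F\<rparr>) v p (head G e)"
      using tree_walk_exists[OF assms(2) ends_in_verts(2)] assms(1) F_subset by blast
    then show ?thesis
    proof (induction p arbitrary: v)
      case Nil
      then show ?case by (auto simp: tree_component_def intro!: exI[of _ "[]"])
    next
      case (Cons ed p)
      obtain e' d where ed: "ed = (e', d)" by fastforce
      let ?s = "if d then tail G e' else head G e'" and ?t = "if d then head G e' else tail G e'"
      have s: "v = ?s" "e' \<in> F" using Cons.prems by (auto simp: ed)
      have IH: "?t \<in> tree_component G F e (head G e) \<or> ?t \<in> tree_component G F e (tail G e)"
        using Cons.IH[of ?t] Cons.prems by (auto simp: ed)
      show ?case
      proof (cases "e' = e")
        case True
        then show ?thesis
          using s F_subset by (auto simp: tree_component_def intro!: exI[of _ "[]"])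
      next
        case False
        then have step: "uwalk ?H ?t [(e', \<not> d)] ?s" using s F_subset by auto
        have "uwalk ?H u q ?t \<Longrightarrow> \<exists>q. uwalk ?H u q ?s" for u q
          using step uwalk_append[OF wfH] by blast
        then show ?thesis using IH s unfolding tree_component_def by blast
      qed
    qed
  qed
  moreover have False
    if both: "v \<in> tree_component G F e (head G e)" "v \<in> tree_component G F e (tail G e)"
  proof -
    obtain p q where "uwalk ?H (head G e) p v" "uwalk ?H (tail G e) q v"
      using both by (auto simp: tree_component_def)
    then have "uwalk ?H (head G e) (p @ rev_walk q) (tail G e)"
      using uwalk_append[OF wfH] uwalk_rev_walk[OF wfH] by blast
    then show False using tree_edge_cut[OF assms(1)] by (auto simp: tree_component_def)
  qed
  ultimately show ?thesis by (auto simp: side_def)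
qed

text \<open>
  A cycle is orthogonal to the coboundary of \<open>side e\<close>; if it is supported on the tree, this
  pairing is twice its coefficient at \<open>e\<close>.
\<close>

lemma tree_cycle_zero:
  assumes "a \<in> H1_Z G" "\<And>e. e \<notin> F \<Longrightarrow> a e = 0"
  shows "a = 0"
proof
  fix e
  show "a e = 0 e"
  proof (cases "e \<in> F")
    case True
    have "0 = (\<Sum>e'\<in>arcs G. a e' * (side e (head G e') - side e (tail G e')))"
      using sum_divergence[of "side e" a] assms(1) by (simp add: H1_Z_iff)
    also have "\<dots> = (\<Sum>e'\<in>F. a e' * (if e' = e then 2 else 0))"
      using assms(2) F_subset True
      by (intro sum.mono_neutral_cong_right) (auto simp: side_coboundary)
    also have "\<dots> = 2 * a e" using True by (simp add: if_distrib sum.delta cong: if_cong)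
    finally show ?thesis by simp
  qed (use assms(2) in simp)
qed

lemma avec_unique:
  assumes "a \<in> H1_Z G" "a \<epsilon> = 1" "\<And>e. e \<notin> insert \<epsilon> F \<Longrightarrow> a e = 0"
  shows "avec G F \<epsilon> = a"
  unfolding avec_def
proof (rule the_equality)
  fix b assume b: "b \<in> H1_Z G \<and> b \<epsilon> = 1 \<and> (\<forall>e. e \<notin> insert \<epsilon> F \<longrightarrow> b e = 0)"
  have "b - a = 0"
    using b assms by (intro tree_cycle_zero H1_Z_diff) (auto, metis)
  then show "b = a" by simp
qed (use assms in auto)

text \<open>
  The fundamental cycle is \<open>\<epsilon>\<close> followed by the tree walk from its head back to its tail, so its
  coefficients on the tree are half the increments of \<open>side\<close>.
\<close>

lemma avec_props:
  assumes "\<epsilon> \<in> arcs G - F"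
  shows "avec G F \<epsilon> \<in> H1_Z G" (is ?A)
    and "avec G F \<epsilon> \<epsilon> = 1" (is ?B)
    and "e \<notin> insert \<epsilon> F \<Longrightarrow> avec G F \<epsilon> e = 0" (is "_ \<Longrightarrow> ?C e")
    and "e \<in> F \<Longrightarrow> avec G F \<epsilon> e = (side e (tail G \<epsilon>) - side e (head G \<epsilon>)) / 2" (is "_ \<Longrightarrow> ?D e")
proof -
  obtain p where p: "uwalk (G\<lparr>arcs := F\<rparr>) (tail G \<epsilon>) p (head G \<epsilon>)"
    using tree_walk_exists[of "tail G \<epsilon>" "head G \<epsilon>"] assms by auto
  define a where "a = walk_chain [(\<epsilon>, True)] - walk_chain p"
  have "a \<in> H1_Z G"
    unfolding a_def using assms tree_walk_imp_walk[OF p]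
    by (intro closed_walk_chain_H1_Z[OF fin_digraph, of "tail G \<epsilon>" _ "head G \<epsilon>"]) auto
  moreover have "a \<epsilon> = 1" and out: "\<And>e. e \<notin> insert \<epsilon> F \<Longrightarrow> a e = 0"
    using assms tree_walk_chain_outside[OF p] by (auto simp: a_def)
  ultimately have a: "avec G F \<epsilon> = a" by (rule avec_unique)
  show ?A ?B "e \<notin> insert \<epsilon> F \<Longrightarrow> ?C e"
    unfolding a using \<open>a \<in> H1_Z G\<close> \<open>a \<epsilon> = 1\<close> out by auto
  show "?D e" if "e \<in> F"
    unfolding a using that assms tree_walk_chain[OF p that] by (auto simp: a_def field_simps)
qed

text \<open>
  The sign is the mean of \<open>side e\<close> over the two ends of \<open>\<epsilon>\<close>: the values cancel exactly when the
  ends are separated by \<open>e\<close>, that is, when \<open>e\<close> lies on the fundamental cycle of \<open>\<epsilon>\<close>.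
\<close>

lemma tree_sgn_eq:
  assumes "e \<in> F" "\<epsilon> \<in> arcs G - F"
  shows "tree_sgn G F e \<epsilon> = (side e (tail G \<epsilon>) + side e (head G \<epsilon>)) / 2"
proof -
  have *: "v \<in> tree_component G F e (head G e) \<longleftrightarrow> side e v = 1" for v
    by (simp add: side_def)
  have "side e v = 1 \<or> side e v = - 1" for v by (simp add: side_def)
  from this[of "tail G \<epsilon>"] this[of "head G \<epsilon>"] show ?thesis
    using assms side_tail_component[OF assms(1), of "tail G \<epsilon>"]
      side_tail_component[OF assms(1), of "head G \<epsilon>"]
    by (auto simp: tree_sgn_def avec_props(4)[OF assms(2,1)] *)
qed

text \<open>
  Both sides have the same coefficients off the tree, and a cycle inside the tree vanishes.
\<close>

lemma cycle_expansion:
  assumes "\<omega> \<in> H1_Z G"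
  shows "\<omega> = (\<Sum>\<epsilon>\<in>arcs G - F. \<omega> \<epsilon> *\<^sub>R avec G F \<epsilon>)"
proof -
  let ?s = "\<Sum>\<epsilon>\<in>arcs G - F. \<omega> \<epsilon> *\<^sub>R avec G F \<epsilon>"
  have "\<omega> - ?s = 0"
  proof (rule tree_cycle_zero)
    show "\<omega> - ?s \<in> H1_Z G"
      using assms by (intro H1_Z_diff H1_Z_sum H1_Z_scale avec_props) (auto simp: H1_Z_iff)
  next
    fix e assume e: "e \<notin> F"
    have "?s e = (\<Sum>\<epsilon>\<in>arcs G - F. if \<epsilon> = e then \<omega> \<epsilon> else 0)"
      unfolding sum_fun_apply using e by (intro sum.cong) (auto simp: avec_props(2,3))
    then show "(\<omega> - ?s) e = 0"
      using assms e by (simp add: sum.delta H1_Z_iff)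
  qed
  then show ?thesis by simp
qed

text \<open>
  This is the expansion of cycles read dually: \<open>b\<^sub>e\<close> evaluates a harmonic form at \<open>e\<close>, and harmonic
  forms are cycles.
\<close>

lemma bvec_expansion: "bvec G e = (\<Sum>\<epsilon>\<in>arcs G - F. avec G F \<epsilon> e *\<^sub>R bvec G \<epsilon>)"
proof (rule dual_eqI[of _ G])
  fix \<omega> assume \<omega>: "\<omega> \<in> Omega_Z G"
  have "\<omega> e = (\<Sum>\<epsilon>\<in>arcs G - F. \<omega> \<epsilon> *\<^sub>R avec G F \<epsilon>) e"
    using cycle_expansion[of \<omega>] \<omega> by (simp add: Omega_Z_eq_H1_Z)
  then show "bvec G e \<omega> = (\<Sum>\<epsilon>\<in>arcs G - F. avec G F \<epsilon> e *\<^sub>R bvec G \<epsilon>) \<omega>"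
    using \<omega> by (simp add: sum_fun_apply bvec_apply mult.commute)
qed (auto intro: bvec_in_dual dual_sum dual_scale)

section \<open>The Abel-Jacobi image in the coordinates of a tree\<close>

text \<open>
  A lift to \<open>\<Omega>\<^sup>\<or>\<close> of the Abel-Jacobi map on the vertices. It is normalised by the symmetric values
  \<open>\<plusminus> 1/2\<close> on the two sides of each tree edge rather than by a vertex that is sent to \<open>0\<close>: the sum of
  the positions of the two ends of \<open>\<epsilon>\<close> then has the coefficients \<open>sgn(e, \<epsilon>) \<ell>(e)\<close>.
\<close>

definition position :: "'v \<Rightarrow> 'e covec" where
  "position v = (\<Sum>e\<in>F. (len e * side e v / 2) *\<^sub>R bvec G e)"

text \<open>
  The value \<open>0\<close> on tree edges lets the formula for the step along an edge, and everything derived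
  from it, treat all edges alike.
\<close>

definition fundamental_cycle :: "'e \<Rightarrow> 'e \<Rightarrow> real" where
  "fundamental_cycle e = (if e \<in> F then 0 else avec G F e)"

definition period :: "'e \<Rightarrow> 'e covec" where
  "period e = chain_integral G len (fundamental_cycle e)"

lemma position_in_dual: "position v \<in> dual G"
  by (simp add: position_def dual_sum dual_scale bvec_in_dual)

lemma period_in_lattice: "e \<in> arcs G \<Longrightarrow> period e \<in> lattice G len"
  by (auto simp: period_def lattice_def fundamental_cycle_def avec_props)

lemma chain_integral_tree_walk:
  assumes "uwalk (G\<lparr>arcs := F\<rparr>) u p v"
  shows "chain_integral G len (walk_chain p) = position v - position u"
proof -
  have "chain_integral G len (walk_chain p) = (\<Sum>e\<in>F. (walk_chain p e * len e) *\<^sub>R bvec G e)"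
    unfolding chain_integral_eq using F_subset tree_walk_chain_outside[OF assms]
    by (intro sum.mono_neutral_right) auto
  also have "\<dots> = (\<Sum>e\<in>F. (len e * side e v / 2) *\<^sub>R bvec G e - (len e * side e u / 2) *\<^sub>R bvec G e)"
  proof (rule sum.cong)
    fix e assume "e \<in> F"
    then have "walk_chain p e * len e = len e * side e v / 2 - len e * side e u / 2"
      by (simp add: tree_walk_chain[OF assms] field_simps)
    then show "(walk_chain p e * len e) *\<^sub>R bvec G e
        = (len e * side e v / 2) *\<^sub>R bvec G e - (len e * side e u / 2) *\<^sub>R bvec G e"
      by (simp only: scaleR_left_diff_distrib)
  qed simp
  finally show ?thesis by (simp add: position_def sum_subtractf)
qed

lemma chain_integral_arc:
  assumes "e \<in> arcs G"
  shows "chain_integral G len (\<lambda>x. if x = e then 1 else 0) = len e *\<^sub>R bvec G e"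
proof -
  have "chain_integral G len (\<lambda>x. if x = e then 1 else 0)
      = (\<Sum>x\<in>arcs G. if x = e then len e *\<^sub>R bvec G e else 0)"
    unfolding chain_integral_eq by (intro sum.cong) auto
  then show ?thesis using assms by (simp add: sum.delta)
qed

lemma position_step:
  assumes "e \<in> arcs G"
  shows "position (tail G e) + len e *\<^sub>R bvec G e = position (head G e) + period e"
proof -
  obtain p where p: "uwalk (G\<lparr>arcs := F\<rparr>) (tail G e) p (head G e)"
    using tree_walk_exists assms by (meson ends_in_verts)
  have "fundamental_cycle e = (\<lambda>x. if x = e then 1 else 0) - walk_chain p"
  proof (rule ext)
    fix x
    show "fundamental_cycle e x = ((\<lambda>x. if x = e then 1 else 0) - walk_chain p) x"
    proof (cases "e \<in> F")
      case True
      have "walk_chain p x = (if x = e then 1 else 0)"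
        using tree_walk_chain[OF p, of x] tree_walk_chain_outside[OF p, of x]
          side_coboundary[of x e] True by (cases "x \<in> F") auto
      then show ?thesis using True by (simp add: fundamental_cycle_def)
    next
      case False
      then have e: "e \<in> arcs G - F" using assms by simp
      have "avec G F e x = (if x = e then 1 else 0) - walk_chain p x"
        using tree_walk_chain[OF p, of x] tree_walk_chain_outside[OF p, of x] e
          avec_props(2)[OF e] avec_props(3)[OF e, of x] avec_props(4)[OF e, of x]
        by (cases "x \<in> F") (auto simp: field_simps)
      then show ?thesis using False by (simp add: fundamental_cycle_def)
    qed
  qed
  then have "period e = len e *\<^sub>R bvec G e - (position (head G e) - position (tail G e))"
    by (simp only: period_def chain_integral_diff chain_integral_arc[OF assms]
        chain_integral_tree_walk[OF p])
  then show ?thesis by (simp only:) (simp add: algebra_simps)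
qed

text \<open>
  A tree walk realises the difference of positions; any other walk differs from it by a closed
  walk, and every lattice vector is the integral along a closed walk.
\<close>

lemma chain_integral_walks:
  assumes "u \<in> verts G" "v \<in> verts G"
  shows "{chain_integral G len (walk_chain p) | p. uwalk G u p v}
    = {(position v - position u) + \<mu> | \<mu>. \<mu> \<in> lattice G len}" (is "?L = ?R")
proof -
  obtain q where q: "uwalk (G\<lparr>arcs := F\<rparr>) u q v" using tree_walk_exists assms by blast
  note qG = tree_walk_imp_walk[OF q] and pos = chain_integral_tree_walk[OF q]
  show ?thesis
  proof (intro equalityI subsetI)
    fix x assume "x \<in> ?L"
    then obtain p where p: "x = chain_integral G len (walk_chain p)" "uwalk G u p v" by blast
    have "chain_integral G len (walk_chain p - walk_chain q) \<in> lattice G len"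
      using closed_walk_chain_H1_Z[OF fin_digraph p(2) qG] by (simp add: lattice_def)
    moreover have "x = (position v - position u) + chain_integral G len (walk_chain p - walk_chain q)"
      by (simp add: p(1) chain_integral_diff pos[symmetric])
    ultimately show "x \<in> ?R" by blast
  next
    fix x assume "x \<in> ?R"
    then obtain a where a: "a \<in> H1_Z G" "x = (position v - position u) + chain_integral G len a"
      by (auto simp: lattice_def)
    then obtain p where p: "uwalk G u p u" "walk_chain p = a"
      using H1_Z_closed_walk[OF assms(1)] by blast
    have "uwalk G u (p @ q) v" using p qG uwalk_append[OF wf] by blast
    moreover have "x = chain_integral G len (walk_chain (p @ q))"
      using a p by (simp add: walk_chain_append chain_integral_add pos algebra_simps)
    ultimately show "x \<in> ?L" by blast
  qed
qed

end

section \<open>Exterior powers\<close>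

lemma vwedge_diff_left: "vwedge (u - v) w = vwedge u w - vwedge v w"
  by (auto simp: vwedge_def fun_eq_iff algebra_simps sum_subtractf)

lemma vwedge_add_right: "vwedge v (w + w') = vwedge v w + vwedge v w'"
  by (auto simp: vwedge_def fun_eq_iff algebra_simps sum.distrib)

lemma vwedge_scaleR_right: "vwedge v (r *\<^sub>R w) = r *\<^sub>R vwedge v w"
  by (auto simp: vwedge_def fun_eq_iff algebra_simps sum_distrib_left)

lemma vwedge_zero_left [simp]: "vwedge 0 w = 0"
  by (auto simp: vwedge_def fun_eq_iff)

lemma vwedge_zero_right [simp]: "vwedge v 0 = 0"
  by (auto simp: vwedge_def fun_eq_iff)

lemma vwedge_wedge: "vwedge v (wedge vs) = wedge (v # vs)"
  by (simp add: wedge_def)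

lemma wedge_1: "wedge [v] = (\<lambda>\<omega>s. if length \<omega>s = 1 then v (\<omega>s ! 0) else 0)"
proof
  fix \<omega>s :: "('a \<Rightarrow> real) list"
  show "wedge [v] \<omega>s = (if length \<omega>s = 1 then v (\<omega>s ! 0) else 0)"
  proof (cases \<omega>s rule: remdups_adj.cases)
    case (3 x y zs)
    then have "drop_nth i \<omega>s \<noteq> []" for i by (cases i) (auto simp: drop_nth_def)
    then show ?thesis using 3 by (simp add: wedge_def vwedge_def)
  qed (auto simp: wedge_def vwedge_def drop_nth_def)
qed

lemma length_drop_nth: "i < length xs \<Longrightarrow> length (drop_nth i xs) = length xs - 1"
  by (auto simp: drop_nth_def)

lemma wedge_2:
  "wedge [u, v] = (\<lambda>\<omega>s. if length \<omega>s = 2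
     then u (\<omega>s ! 0) * v (\<omega>s ! 1) - u (\<omega>s ! 1) * v (\<omega>s ! 0) else 0)"
proof
  fix \<omega>s :: "('a \<Rightarrow> real) list"
  have eq: "wedge [u, v] \<omega>s = (\<Sum>i<length \<omega>s. (-1) ^ i * u (\<omega>s ! i) * wedge [v] (drop_nth i \<omega>s))"
    by (simp add: vwedge_def flip: vwedge_wedge)
  show "wedge [u, v] \<omega>s = (if length \<omega>s = 2
     then u (\<omega>s ! 0) * v (\<omega>s ! 1) - u (\<omega>s ! 1) * v (\<omega>s ! 0) else 0)"
  proof (cases "length \<omega>s = 2")
    case True
    then have "{..<length \<omega>s} = {0, 1}" by auto
    moreover have "drop_nth 0 \<omega>s = [\<omega>s ! 1]" "drop_nth 1 \<omega>s = [\<omega>s ! 0]"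
      using True by (auto simp: drop_nth_def length_Suc_conv numeral_2_eq_2)
    ultimately show ?thesis using True unfolding eq by (simp add: wedge_1)
  next
    case False
    then have "length (drop_nth i \<omega>s) \<noteq> 1" if "i < length \<omega>s" for i
      using that by (simp add: length_drop_nth)
    then show ?thesis using False unfolding eq by (simp add: wedge_1)
  qed
qed

lemma wedge_1_add: "wedge [u + v] = wedge [u] + wedge [v]"
  by (auto simp: wedge_1)

lemma wedge_2_add_left: "wedge [u + u', v] = wedge [u, v] + wedge [u', v]"
  and wedge_2_add_right: "wedge [u, v + v'] = wedge [u, v] + wedge [u, v']"
  and wedge_2_diff_right: "wedge [u, v - v'] = wedge [u, v] - wedge [u, v']"
  and wedge_2_uminus_left: "wedge [- u, v] = - wedge [u, v]"
  and wedge_2_scaleR_left: "wedge [r *\<^sub>R u, v] = r *\<^sub>R wedge [u, v]"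
  and wedge_2_scaleR_right: "wedge [u, r *\<^sub>R v] = r *\<^sub>R wedge [u, v]"
  and wedge_2_swap: "wedge [u, v] = - wedge [v, u]"
  by (auto simp: wedge_2 fun_eq_iff algebra_simps)

lemma wedge_2_self [simp]: "wedge [v, v] = 0"
  by (auto simp: wedge_2 fun_eq_iff)

lemma wedge_2_zero [simp]: "wedge [0, v] = 0" "wedge [v, 0] = 0"
  by (auto simp: wedge_2 fun_eq_iff)

lemma wedge_1_uminus: "wedge [- v] = - wedge [v]"
  by (auto simp: wedge_1 fun_eq_iff)

lemma wedge_2_sum_left: "wedge [\<Sum>i\<in>I. u i, v] = (\<Sum>i\<in>I. wedge [u i, v])"
  using sum_comp_morphism[of "\<lambda>u. wedge [u, v]" u I] by (simp add: wedge_2_add_left o_def)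

lemma wedge_2_sum_right: "wedge [u, \<Sum>i\<in>I. v i] = (\<Sum>i\<in>I. wedge [u, v i])"
  using sum_comp_morphism[of "\<lambda>v. wedge [u, v]" v I] by (simp add: wedge_2_add_right o_def)

lemma subspace_ext_power: "subspace (ext_power G p)"
  by (simp add: ext_power_def subspace_span)

lemma wedge_in_ext_power: "length vs = p \<Longrightarrow> set vs \<subseteq> dual G \<Longrightarrow> wedge vs \<in> ext_power G p"
  unfolding ext_power_def by (rule span_base) blast

lemma wedge_2_in_ext_power: "u \<in> dual G \<Longrightarrow> v \<in> dual G \<Longrightarrow> wedge [u, v] \<in> ext_power G 2"
  by (rule wedge_in_ext_power) auto

lemma vwedge_in_ext_power:
  assumes "v \<in> dual G" "w \<in> ext_power G p"
  shows "vwedge v w \<in> ext_power G (Suc p)"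
  using assms(2) unfolding ext_power_def[of G p]
proof (induction rule: span_induct_alt)
  case base
  then show ?case using subspace_0[OF subspace_ext_power] by (simp only: vwedge_zero_right)
next
  case (step c x y)
  then obtain vs where vs: "x = wedge vs" "length vs = p" "set vs \<subseteq> dual G" by blast
  then have "vwedge v x \<in> ext_power G (Suc p)"
    unfolding vs(1) vwedge_wedge using assms(1) vs(2,3) by (intro wedge_in_ext_power) auto
  then show ?case
    unfolding vwedge_add_right vwedge_scaleR_right
    using step by (intro subspace_add subspace_scale subspace_ext_power)
qed

lemma module_int_scaleR: "module (\<lambda>(k::int) (w::'a::real_vector). of_int k *\<^sub>R w)"
  by unfold_locales (simp_all add: scaleR_add_right scaleR_add_left)

lemma ext_power_Z_subset: "ext_power_Z G p \<subseteq> ext_power G p"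
proof
  fix w assume "w \<in> ext_power_Z G p"
  then show "w \<in> ext_power G p"
    unfolding ext_power_Z_def
  proof (induction rule: module.span_induct_alt[OF module_int_scaleR, consumes 1, case_names base step])
    case base
    show ?case by (rule subspace_0[OF subspace_ext_power])
  next
    case (step c x y)
    then show ?case
      by (intro subspace_add subspace_scale subspace_ext_power) (auto intro!: wedge_in_ext_power simp: dual_Z_def)
  qed
qed

lemma wedge_in_ext_power_Z: "length vs = p \<Longrightarrow> set vs \<subseteq> dual_Z G \<Longrightarrow> wedge vs \<in> ext_power_Z G p"
  unfolding ext_power_Z_def by (rule module.span_base[OF module_int_scaleR]) blast

section \<open>Chains with coefficients\<close>

definition add_subgroup :: "'a::ab_group_add set \<Rightarrow> bool" where
  "add_subgroup S \<longleftrightarrow> 0 \<in> S \<and> (\<forall>x\<in>S. \<forall>y\<in>S. x - y \<in> S)"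

lemma add_subgroup_zero: "add_subgroup S \<Longrightarrow> 0 \<in> S"
  and add_subgroup_diff: "add_subgroup S \<Longrightarrow> x \<in> S \<Longrightarrow> y \<in> S \<Longrightarrow> x - y \<in> S"
  by (auto simp: add_subgroup_def)

lemma add_subgroup_uminus: "add_subgroup S \<Longrightarrow> x \<in> S \<Longrightarrow> - x \<in> S"
  using add_subgroup_diff[of S 0 x] add_subgroup_zero[of S] by simp

lemma add_subgroup_add: "add_subgroup S \<Longrightarrow> x \<in> S \<Longrightarrow> y \<in> S \<Longrightarrow> x + y \<in> S"
  using add_subgroup_diff[of S x "- y"] add_subgroup_uminus[of S y] by simp

lemma add_subgroup_sum: "add_subgroup S \<Longrightarrow> (\<And>i. i \<in> I \<Longrightarrow> f i \<in> S) \<Longrightarrow> (\<Sum>i\<in>I. f i) \<in> S"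
  by (induction I rule: infinite_finite_induct)
    (simp_all only: sum.infinite sum.empty sum.insert add_subgroup_zero add_subgroup_add
      insertI1 insertI2 not_False_eq_True)

lemma add_subgroup_subspace: "subspace S \<Longrightarrow> add_subgroup S"
  by (simp add: add_subgroup_def subspace_0 subspace_diff)

lemma add_subgroup_ext_power_Z: "add_subgroup (ext_power_Z G p)"
  unfolding add_subgroup_def ext_power_Z_def
  using module.span_zero[OF module_int_scaleR] module.span_diff[OF module_int_scaleR] by blast

lemma elt_set_plus_eq_iff:
  assumes "add_subgroup S"
  shows "c +o S = d +o S \<longleftrightarrow> c - d \<in> S"
proof
  assume "c +o S = d +o S"
  moreover have "c \<in> c +o S" using add_subgroup_zero[OF assms] by (auto simp: elt_set_plus_def)
  ultimately show "c - d \<in> S" by (auto simp: elt_set_plus_def)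
next
  assume cd: "c - d \<in> S"
  have "c + x = d + ((c - d) + x)" "d + x = c + (x - (c - d))" for x by simp_all
  then show "c +o S = d +o S"
    unfolding elt_set_plus_def using cd add_subgroup_add[OF assms] add_subgroup_diff[OF assms]
    by (auto, metis+)
qed

definition lin_ext :: "('k \<Rightarrow> 'a::zero \<Rightarrow> 'b::ab_group_add) \<Rightarrow> ('k \<Rightarrow>\<^sub>0 'a) \<Rightarrow> 'b" where
  "lin_ext f c = (\<Sum>P\<in>Poly_Mapping.keys c. f P (Poly_Mapping.lookup c P))"

lemma lin_ext_superset:
  assumes "\<And>P. f P 0 = 0" "finite S" "Poly_Mapping.keys c \<subseteq> S"
  shows "lin_ext f c = (\<Sum>P\<in>S. f P (Poly_Mapping.lookup c P))"
  unfolding lin_ext_def using assms by (intro sum.mono_neutral_left) (auto simp: in_keys_iff)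

lemma additive_lin_ext:
  fixes f :: "'k \<Rightarrow> 'a::ab_group_add \<Rightarrow> 'b::ab_group_add"
  assumes "\<And>P. additive (f P)"
  shows "additive (lin_ext f)"
proof
  fix c d :: "'k \<Rightarrow>\<^sub>0 'a"
  have f0: "f P 0 = 0" for P by (rule additive.zero[OF assms])
  let ?S = "Poly_Mapping.keys c \<union> Poly_Mapping.keys d"
  have "lin_ext f x = (\<Sum>P\<in>?S. f P (Poly_Mapping.lookup x P))" if "x \<in> {c, d, c + d}" for x
    using that keys_add[of c d] by (intro lin_ext_superset f0) auto
  then show "lin_ext f (c + d) = lin_ext f c + lin_ext f d"
    by (simp add: lookup_add additive.add[OF assms] sum.distrib)
qed

lemma lin_ext_single: "f P 0 = 0 \<Longrightarrow> lin_ext f (Poly_Mapping.single P w) = f P w"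
  by (simp add: lin_ext_def)

lemma additive_single: "additive (Poly_Mapping.single P)"
  by unfold_locales (simp add: single_add)

lemmas single_uminus = additive.minus[OF additive_single]
lemmas single_diff = additive.diff[OF additive_single]
lemmas single_sum = additive.sum[OF additive_single]

lemma chain_eq_sum_single:
  fixes c :: "'k \<Rightarrow>\<^sub>0 'a::ab_group_add"
  shows "c = (\<Sum>P\<in>Poly_Mapping.keys c. Poly_Mapping.single P (Poly_Mapping.lookup c P))"
  by (rule poly_mapping_eqI)
    (auto simp: lookup_sum lookup_single when_def in_keys_iff sum.delta)

lemma additive_sum_single:
  fixes f :: "('k \<Rightarrow>\<^sub>0 'a::ab_group_add) \<Rightarrow> 'b::ab_group_add"
  assumes "additive f"
  shows "f c = (\<Sum>P\<in>Poly_Mapping.keys c. f (Poly_Mapping.single P (Poly_Mapping.lookup c P)))"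
  using arg_cong[OF chain_eq_sum_single[of c], of f] unfolding additive.sum[OF assms] .

lemma additive_eqI:
  fixes f g :: "('k \<Rightarrow>\<^sub>0 'a::ab_group_add) \<Rightarrow> 'b::ab_group_add"
  assumes "additive f" "additive g"
    and "\<And>P. P \<in> Poly_Mapping.keys c \<Longrightarrow>
      f (Poly_Mapping.single P (Poly_Mapping.lookup c P)) = g (Poly_Mapping.single P (Poly_Mapping.lookup c P))"
  shows "f c = g c"
  using additive_sum_single[OF assms(1), of c] additive_sum_single[OF assms(2), of c] assms(3)
  by (metis (mono_tags, lifting) sum.cong)

lemma add_subgroup_chains:
  assumes "add_subgroup T"
  shows "add_subgroup {c. \<forall>P\<in>Poly_Mapping.keys c. P \<in> S \<and> Poly_Mapping.lookup c P \<in> T}"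
    (is "add_subgroup ?C")
proof -
  have "c - d \<in> ?C" if cd: "c \<in> ?C" "d \<in> ?C" for c d
  proof -
    have lookup: "Poly_Mapping.lookup x P \<in> T" if "x \<in> ?C" for x P
    proof (cases "P \<in> Poly_Mapping.keys x")
      case True
      then show ?thesis using that by simp
    next
      case False
      then show ?thesis using add_subgroup_zero[OF assms] by (simp add: in_keys_iff)
    qed
    have "P \<in> S" if "P \<in> Poly_Mapping.keys (c - d)" for P
    proof (cases "P \<in> Poly_Mapping.keys c")
      case True
      then show ?thesis using cd(1) by simp
    next
      case False
      then have "P \<in> Poly_Mapping.keys d" using that by (auto simp: in_keys_iff lookup_minus)
      then show ?thesis using cd(2) by simp
    qed
    moreover have "Poly_Mapping.lookup (c - d) P \<in> T" for P
      unfolding lookup_minus by (intro add_subgroup_diff assms lookup cd)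
    ultimately show ?thesis by simp
  qed
  moreover have "0 \<in> ?C" by simp
  ultimately show ?thesis unfolding add_subgroup_def by blast
qed

lemma add_subgroup_chains_R: "add_subgroup (chains_R G len p q)"
  unfolding chains_R_def by (intro add_subgroup_chains add_subgroup_subspace subspace_ext_power)

lemma add_subgroup_chains_Z: "add_subgroup (chains_Z G len p q)"
  unfolding chains_Z_def by (intro add_subgroup_chains add_subgroup_ext_power_Z)

lemma single_in_chains_R:
  "P \<in> jac_simplices G len q \<Longrightarrow> w \<in> ext_power G p \<Longrightarrow> Poly_Mapping.single P w \<in> chains_R G len p q"
  by (simp add: chains_R_def)

lemma single_in_chains_Z:
  "P \<in> jac_simplices G len q \<Longrightarrow> w \<in> ext_power_Z G p \<Longrightarrow> Poly_Mapping.single P w \<in> chains_Z G len p q"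
  by (simp add: chains_Z_def)

section \<open>Cells of the Jacobian\<close>

lemma cell_translate:
  assumes "\<mu> \<in> lattice G len"
  shows "cell G len (map ((+) \<mu>) xs) = cell G len xs"
proof -
  have 1: "map ((+) \<nu>) (map ((+) \<mu>) xs) = map ((+) (\<nu> + \<mu>)) xs" for \<nu>
    by (simp add: add.assoc)
  have 2: "map ((+) \<nu>) xs = map ((+) (\<nu> - \<mu>)) (map ((+) \<mu>) xs)" for \<nu>
    by (simp add: add.assoc[symmetric])
  show ?thesis
    unfolding cell_def
  proof (intro equalityI subsetI; elim CollectE exE conjE)
    fix ys \<nu> assume "ys = map ((+) \<nu>) (map ((+) \<mu>) xs)" "\<nu> \<in> lattice G len"
    then show "ys \<in> {map ((+) \<mu>) xs |\<mu>. \<mu> \<in> lattice G len}"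
      unfolding 1 using lattice_add assms by blast
  next
    fix ys \<nu> assume "ys = map ((+) \<nu>) xs" "\<nu> \<in> lattice G len"
    then show "ys \<in> {map ((+) \<nu>) (map ((+) \<mu>) xs) |\<nu>. \<nu> \<in> lattice G len}"
      using 2[of \<nu>] lattice_diff assms by blast
  qed
qed

lemma drop_nth_map: "drop_nth i (map f xs) = map f (drop_nth i xs)"
  by (simp add: drop_nth_def take_map drop_map)

lemma facet_cell: "drop_nth i ` cell G len xs = cell G len (drop_nth i xs)"
  unfolding cell_def by (auto simp: drop_nth_map image_iff) (metis drop_nth_map)

lemma some_in_cell: "\<exists>\<mu>\<in>lattice G len. (SOME ys. ys \<in> cell G len xs) = map ((+) \<mu>) xs"
proof -
  have "map ((+) 0) xs \<in> cell G len xs" unfolding cell_def using lattice_0 by blast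
  then have "(SOME ys. ys \<in> cell G len xs) \<in> cell G len xs" by (rule someI)
  then show ?thesis by (auto simp: cell_def)
qed

lemma set_drop_nth: "set (drop_nth i xs) \<subseteq> set xs"
  unfolding drop_nth_def using set_take_subset set_drop_subset by fastforce

lemma cell_points_diff:
  assumes "cell_points G len pt" "cell_points G len pt'" "set xs \<subseteq> dual G" "set ys \<subseteq> dual G"
    "xs \<noteq> []" "ys \<noteq> []" "\<mu> \<in> lattice G len"
  shows "pt (map ((+) \<mu>) xs) - pt' (map ((+) \<mu>) ys) = pt xs - pt' ys"
  using assms by (simp add: cell_points_def)

lemma boundary_eq_lin_ext:
  "boundary 2 = lin_ext (\<lambda>P w. \<Sum>i\<le>2. Poly_Mapping.single (drop_nth i ` P) ((-1) ^ i *\<^sub>R w))"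
  by (simp add: boundary_def lin_ext_def fun_eq_iff)

lemma additive_boundary: "additive (boundary 2)"
  unfolding boundary_eq_lin_ext
  by (intro additive_lin_ext, unfold_locales)
    (simp add: scaleR_add_right single_add sum.distrib)

lemma boundary_single:
  "boundary 2 (Poly_Mapping.single (cell G len xs) w) =
    (\<Sum>i\<le>2. Poly_Mapping.single (cell G len (drop_nth i xs)) ((-1) ^ i *\<^sub>R w))"
  unfolding boundary_eq_lin_ext by (subst lin_ext_single) (simp_all add: facet_cell)

lemma monodromy_eq_lin_ext:
  "monodromy pt 2 = lin_ext (\<lambda>P w. \<Sum>i\<le>2. let xs = (SOME xs. xs \<in> P) in
     Poly_Mapping.single (drop_nth i ` P) ((-1) ^ i *\<^sub>R vwedge (pt xs - pt (drop_nth i xs)) w))"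
  by (simp add: monodromy_def lin_ext_def fun_eq_iff)

lemma additive_monodromy: "additive (monodromy pt 2)"
  unfolding monodromy_eq_lin_ext
  by (intro additive_lin_ext, unfold_locales)
    (simp add: Let_def vwedge_add_right scaleR_add_right single_add sum.distrib)

lemma monodromy_single:
  assumes "cell_points G len pt" "length xs = 3" "set xs \<subseteq> dual G"
  shows "monodromy pt 2 (Poly_Mapping.single (cell G len xs) w) =
    (\<Sum>i\<le>2. Poly_Mapping.single (cell G len (drop_nth i xs))
       ((-1) ^ i *\<^sub>R vwedge (pt xs - pt (drop_nth i xs)) w))"
proof -
  obtain \<mu> where \<mu>: "\<mu> \<in> lattice G len" "(SOME ys. ys \<in> cell G len xs) = map ((+) \<mu>) xs"
    using some_in_cell by blast
  have eq: "pt (map ((+) \<mu>) xs) - pt (drop_nth i (map ((+) \<mu>) xs)) = pt xs - pt (drop_nth i xs)"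
    if "i \<le> 2" for i
  proof -
    have "length (drop_nth i xs) = 2" using that assms(2) by (simp add: length_drop_nth)
    then show ?thesis
      unfolding drop_nth_map using assms \<mu>(1) set_drop_nth[of i xs]
      by (intro cell_points_diff[of G len]) auto
  qed
  show ?thesis
    unfolding monodromy_eq_lin_ext
    by (subst lin_ext_single) (simp_all add: facet_cell \<mu>(2) eq Let_def)
qed

text \<open>
  The chain homotopy between the monodromy operators of two choices of points: wedging with the
  vector from the second point of each cell to the first. Writing \<open>d\<^sub>P\<close> for this vector, the vectors
  \<open>o\<^sub>P - o\<^sub>Q\<close> of the two choices differ by \<open>d\<^sub>P - d\<^sub>Q\<close>. The part with \<open>d\<^sub>P\<close> is the boundary of the
  homotopy, the part with \<open>d\<^sub>Q\<close> is the homotopy of the boundary.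
\<close>

definition point_homotopy ::
  "('e covec list \<Rightarrow> 'e covec) \<Rightarrow> ('e covec list \<Rightarrow> 'e covec) \<Rightarrow> 'e chain \<Rightarrow> 'e chain" where
  "point_homotopy pt pt' = lin_ext (\<lambda>P w. let xs = (SOME xs. xs \<in> P) in
     Poly_Mapping.single P (vwedge (pt xs - pt' xs) w))"

lemma additive_point_homotopy: "additive (point_homotopy pt pt')"
  unfolding point_homotopy_def
  by (intro additive_lin_ext, unfold_locales) (simp add: Let_def vwedge_add_right single_add)

lemma point_homotopy_single:
  assumes "cell_points G len pt" "cell_points G len pt'" "xs \<noteq> []" "set xs \<subseteq> dual G"
  shows "point_homotopy pt pt' (Poly_Mapping.single (cell G len xs) w) =
    Poly_Mapping.single (cell G len xs) (vwedge (pt xs - pt' xs) w)"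
proof -
  obtain \<mu> where \<mu>: "\<mu> \<in> lattice G len" "(SOME ys. ys \<in> cell G len xs) = map ((+) \<mu>) xs"
    using some_in_cell by blast
  then show ?thesis
    unfolding point_homotopy_def
    using cell_points_diff[OF assms(1,2,4,4,3,3) \<mu>(1)]
    by (subst lin_ext_single) (simp_all add: Let_def)
qed

lemma point_homotopy_in_chains_R:
  assumes pts: "cell_points G len pt" "cell_points G len pt'" and c: "c \<in> chains_Z G len 1 2"
  shows "point_homotopy pt pt' c \<in> chains_R G len 2 2"
proof -
  have "point_homotopy pt pt' (Poly_Mapping.single P (Poly_Mapping.lookup c P)) \<in> chains_R G len 2 2"
    if P: "P \<in> Poly_Mapping.keys c" for P
  proof -
    have jP: "P \<in> jac_simplices G len 2" and w: "Poly_Mapping.lookup c P \<in> ext_power G 1"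
      using c P ext_power_Z_subset unfolding chains_Z_def by blast+
    then obtain xs where xs: "P = cell G len xs" "length xs = 3" "set xs \<subseteq> dual G"
      by (auto simp: jac_simplices_def)
    then have ne: "xs \<noteq> []" by auto
    have "convex (dual G)" by (simp add: subspace_imp_convex subspace_dual)
    then have "convex hull set xs \<subseteq> dual G" using xs(3) by (rule hull_minimal[rotated])
    then have "pt xs - pt' xs \<in> dual G"
      using pts xs(3) ne unfolding cell_points_def by (intro dual_diff) blast+
    from vwedge_in_ext_power[OF this w]
    have "vwedge (pt xs - pt' xs) (Poly_Mapping.lookup c P) \<in> ext_power G 2"
      by (simp add: numeral_2_eq_2)
    then show ?thesis
      unfolding xs(1) point_homotopy_single[OF pts ne xs(3)]
      using jP unfolding xs(1) by (intro single_in_chains_R)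
  qed
  then show ?thesis
    unfolding additive_sum_single[OF additive_point_homotopy, of pt pt' c]
    by (intro add_subgroup_sum add_subgroup_chains_R)
qed

lemma monodromy_homotopy:
  assumes pts: "cell_points G len pt" "cell_points G len pt'" and c: "c \<in> chains_Z G len 1 2"
  shows "monodromy pt 2 c - monodromy pt' 2 c =
    boundary 2 (point_homotopy pt pt' c) - point_homotopy pt pt' (boundary 2 c)"
proof (rule additive_eqI[where c = c])
  show "additive (\<lambda>c. monodromy pt 2 c - monodromy pt' 2 c)"
    by unfold_locales (simp add: additive.add[OF additive_monodromy])
  show "additive (\<lambda>c. boundary 2 (point_homotopy pt pt' c) - point_homotopy pt pt' (boundary 2 c))"
    by unfold_locales
      (simp add: additive.add[OF additive_boundary] additive.add[OF additive_point_homotopy])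
  fix P assume "P \<in> Poly_Mapping.keys c"
  then have "P \<in> jac_simplices G len 2" using c by (auto simp: chains_Z_def)
  then obtain xs where xs: "P = cell G len xs" "length xs = 3" "set xs \<subseteq> dual G"
    by (auto simp: jac_simplices_def)
  let ?w = "Poly_Mapping.lookup c P" and ?f = "\<lambda>i. cell G len (drop_nth i xs)"
  have hom: "point_homotopy pt pt' (Poly_Mapping.single (?f i) w) =
      Poly_Mapping.single (?f i) (vwedge (pt (drop_nth i xs) - pt' (drop_nth i xs)) w)"
    if "i \<le> 2" for i w
  proof -
    have "length (drop_nth i xs) = 2" using that xs(2) by (simp add: length_drop_nth)
    then show ?thesis
      using set_drop_nth[of i xs] xs(3) by (intro point_homotopy_single pts) auto
  qed
  have ne: "xs \<noteq> []" using xs(2) by auto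
  show "monodromy pt 2 (Poly_Mapping.single P ?w) - monodromy pt' 2 (Poly_Mapping.single P ?w) =
    boundary 2 (point_homotopy pt pt' (Poly_Mapping.single P ?w)) -
    point_homotopy pt pt' (boundary 2 (Poly_Mapping.single P ?w))"
    unfolding xs(1) monodromy_single[OF pts(1) xs(2,3)] monodromy_single[OF pts(2) xs(2,3)]
      point_homotopy_single[OF pts ne xs(3)] boundary_single
      additive.sum[OF additive_point_homotopy] sum_subtractf[symmetric]
    by (intro sum.cong refl)
      (simp add: hom vwedge_diff_left vwedge_scaleR_right scaleR_diff_right algebra_simps flip: single_diff)
qed

section \<open>The intermediate Jacobian\<close>

lemma add_subgroup_bounds21: "add_subgroup (bounds21 G len)"
  unfolding add_subgroup_def bounds21_def
proof (intro conjI ballI)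
  show "0 \<in> boundary 2 ` chains_R G len 2 2"
    using add_subgroup_zero[OF add_subgroup_chains_R] additive.zero[OF additive_boundary]
    by (metis imageI)
  fix x y assume "x \<in> boundary 2 ` chains_R G len 2 2" "y \<in> boundary 2 ` chains_R G len 2 2"
  then show "x - y \<in> boundary 2 ` chains_R G len 2 2"
    using add_subgroup_diff[OF add_subgroup_chains_R] additive.diff[OF additive_boundary, symmetric]
    by (smt (verit) imageE imageI)
qed

lemma monodromy_independent:
  assumes "cell_points G len pt" "cell_points G len pt'" "c \<in> chains_Z G len 1 2"
    "point_homotopy pt pt' (boundary 2 c) = 0"
  shows "monodromy pt 2 c - monodromy pt' 2 c \<in> bounds21 G len"
  using monodromy_homotopy[OF assms(1-3)] point_homotopy_in_chains_R[OF assms(1-3)] assms(4)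
  by (simp add: bounds21_def)

lemma cell_points_hd: "cell_points G len hd"
  unfolding cell_points_def
  by (auto simp: hull_inc hd_map add.commute)

lemma L21_zero: "0 \<in> L21 G len"
proof -
  have "0 = monodromy hd 2 0" using additive.zero[OF additive_monodromy] by metis
  then show ?thesis
    unfolding L21_def
    using cell_points_hd add_subgroup_zero[OF add_subgroup_chains_Z] additive.zero[OF additive_boundary]
    by blast
qed

text \<open>
  The elements of \<open>L21\<close> may use different choices of points. On cycles a change of the choice
  costs only a boundary, so two elements can be brought to the same choice before subtracting.
\<close>

lemma add_subgroup_bounds21_L21: "add_subgroup (bounds21 G len + L21 G len)"
proof -
  let ?B = "bounds21 G len" and ?L = "L21 G len"
  have "0 \<in> ?L" by (rule L21_zero)
  then have "0 \<in> ?B + ?L"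
    using set_plus_intro[OF add_subgroup_zero[OF add_subgroup_bounds21], of 0 ?L G len] by simp
  moreover have "x - y \<in> ?B + ?L" if xy: "x \<in> ?B + ?L" "y \<in> ?B + ?L" for x y
  proof -
    obtain b b' l l' where xy_eq: "x = b + l" "y = b' + l'" "b \<in> ?B" "b' \<in> ?B" "l \<in> ?L" "l' \<in> ?L"
      using xy by (auto elim!: set_plus_elim)
    then obtain pt z pt' z' where l: "l = monodromy pt 2 z" "cell_points G len pt"
        "z \<in> chains_Z G len 1 2" "boundary 2 z = 0"
      and l': "l' = monodromy pt' 2 z'" "cell_points G len pt'"
        "z' \<in> chains_Z G len 1 2" "boundary 2 z' = 0"
      unfolding L21_def by blast
    have "boundary 2 (z - z') = 0"
      unfolding additive.diff[OF additive_boundary] l(4) l'(4) by simp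
    then have L: "monodromy pt 2 (z - z') \<in> ?L"
      using l(2) add_subgroup_diff[OF add_subgroup_chains_Z l(3) l'(3)]
      unfolding L21_def by blast
    have "point_homotopy pt pt' (boundary 2 z') = 0"
      unfolding l'(4) by (rule additive.zero[OF additive_point_homotopy])
    then have "monodromy pt 2 z' - monodromy pt' 2 z' \<in> ?B"
      by (intro monodromy_independent l l')
    with add_subgroup_diff[OF add_subgroup_bounds21 xy_eq(3,4)]
    have B: "b - b' + (monodromy pt 2 z' - monodromy pt' 2 z') \<in> ?B"
      by (rule add_subgroup_add[OF add_subgroup_bounds21])
    have eq: "x - y = (b - b' + (monodromy pt 2 z' - monodromy pt' 2 z')) + monodromy pt 2 (z - z')"
      unfolding xy_eq(1,2) l(1) l'(1) additive.diff[OF additive_monodromy] by simp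
    show ?thesis unfolding eq using B L by (rule set_plus_intro)
  qed
  ultimately show ?thesis by (simp add: add_subgroup_def)
qed

section \<open>Segments modulo boundaries\<close>

definition homologous ::
  "('v, 'e) pre_digraph \<Rightarrow> ('e \<Rightarrow> real) \<Rightarrow> 'e chain \<Rightarrow> 'e chain \<Rightarrow> bool" where
  "homologous G len c d \<longleftrightarrow> c - d \<in> bounds21 G len"

lemma homologous_refl [simp]: "homologous G len c c"
  by (simp add: homologous_def add_subgroup_zero[OF add_subgroup_bounds21])

lemma homologous_sym: "homologous G len c d \<Longrightarrow> homologous G len d c"
  unfolding homologous_def using add_subgroup_uminus[OF add_subgroup_bounds21] by fastforce

lemma homologous_add:
  "homologous G len c d \<Longrightarrow> homologous G len c' d' \<Longrightarrow> homologous G len (c + c') (d + d')"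
  unfolding homologous_def
  by (drule (1) add_subgroup_add[OF add_subgroup_bounds21]) (simp add: algebra_simps)

lemma homologous_trans [trans]:
  "homologous G len c d \<Longrightarrow> homologous G len d d' \<Longrightarrow> homologous G len c d'"
  unfolding homologous_def
  by (drule (1) add_subgroup_add[OF add_subgroup_bounds21]) simp

lemma homologous_uminus: "homologous G len c d \<Longrightarrow> homologous G len (- c) (- d)"
  unfolding homologous_def
  by (drule add_subgroup_uminus[OF add_subgroup_bounds21]) simp

lemma homologous_diff:
  "homologous G len c d \<Longrightarrow> homologous G len c' d' \<Longrightarrow> homologous G len (c - c') (d - d')"
  using homologous_add[of G len c d "- c'" "- d'"] by (simp add: homologous_uminus)

lemma homologous_sum:
  assumes "\<And>i. i \<in> I \<Longrightarrow> homologous G len (c i) (d i)"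
  shows "homologous G len (\<Sum>i\<in>I. c i) (\<Sum>i\<in>I. d i)"
  using assms unfolding homologous_def sum_subtractf[symmetric]
  by (intro add_subgroup_sum add_subgroup_bounds21)

definition triangle ::
  "('v, 'e) pre_digraph \<Rightarrow> ('e \<Rightarrow> real) \<Rightarrow> 'e covec \<Rightarrow> 'e covec \<Rightarrow> 'e covec \<Rightarrow> 'e multivec \<Rightarrow> 'e chain"
where "triangle G len x y z w = Poly_Mapping.single (cell G len [x, y, z]) w"

definition segment ::
  "('v, 'e) pre_digraph \<Rightarrow> ('e \<Rightarrow> real) \<Rightarrow> 'e covec \<Rightarrow> 'e covec \<Rightarrow> 'e multivec \<Rightarrow> 'e chain"
where "segment G len x y w = Poly_Mapping.single (cell G len [x, y]) w"

text \<open>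
  Modulo boundaries every segment is a difference of segments from the origin, which serve as
  normal forms.
\<close>

abbreviation ray ::
  "('v, 'e) pre_digraph \<Rightarrow> ('e \<Rightarrow> real) \<Rightarrow> 'e covec \<Rightarrow> 'e multivec \<Rightarrow> 'e chain"
where "ray G len x \<equiv> segment G len 0 x"

lemma segment_add: "segment G len x y (w + w') = segment G len x y w + segment G len x y w'"
  and segment_diff: "segment G len x y (w - w') = segment G len x y w - segment G len x y w'"
  and segment_uminus: "segment G len x y (- w) = - segment G len x y w"
  and segment_zero [simp]: "segment G len x y 0 = 0"
  by (simp_all add: segment_def single_add single_diff single_uminus)

lemma segment_sum: "segment G len x y (\<Sum>i\<in>I. w i) = (\<Sum>i\<in>I. segment G len x y (w i))"
  by (simp add: segment_def single_sum)

lemma segment_translate: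
  "\<mu> \<in> lattice G len \<Longrightarrow> segment G len (\<mu> + x) (\<mu> + y) w = segment G len x y w"
  using cell_translate[of \<mu> G len "[x, y]"] by (simp add: segment_def)

lemma tensor_eq_ray: "tensor G len a w = ray G len (chain_integral G len a) w"
  by (simp add: tensor_def segment_def)

lemma sum_atMost_2: "(\<Sum>i\<le>(2::nat). f i) = f 0 + f 1 + (f 2 :: 'a::comm_monoid_add)"
  by (simp add: numeral_2_eq_2)

lemma boundary_triangle:
  "boundary 2 (triangle G len x y z w) =
    segment G len y z w - segment G len x z w + segment G len x y w"
  unfolding triangle_def boundary_single sum_atMost_2
  by (simp add: drop_nth_def segment_def single_uminus)

text \<open>
  With the first vertex as the chosen point of every simplex, only the facet opposite the first
  vertex has a point different from that of the triangle.
\<close>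

lemma monodromy_hd_triangle:
  assumes "x \<in> dual G" "y \<in> dual G" "z \<in> dual G"
  shows "monodromy hd 2 (triangle G len x y z w) = segment G len y z (vwedge (x - y) w)"
  unfolding triangle_def sum_atMost_2
  by (subst monodromy_single[OF cell_points_hd])
    (use assms in \<open>simp_all add: sum_atMost_2 drop_nth_def segment_def\<close>)

lemma triangle_in_chains_R:
  assumes "x \<in> dual G" "y \<in> dual G" "z \<in> dual G" "w \<in> ext_power G 2"
  shows "triangle G len x y z w \<in> chains_R G len 2 2"
  unfolding triangle_def using assms
  by (intro single_in_chains_R) (auto simp: jac_simplices_def intro!: exI[of _ "[x, y, z]"])

lemma triangle_in_chains_Z:
  assumes "x \<in> dual G" "y \<in> dual G" "z \<in> dual G" "w \<in> ext_power_Z G 1"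
  shows "triangle G len x y z w \<in> chains_Z G len 1 2"
  unfolding triangle_def using assms
  by (intro single_in_chains_Z) (auto simp: jac_simplices_def intro!: exI[of _ "[x, y, z]"])

lemma segment_homologous:
  assumes "x \<in> dual G" "y \<in> dual G" "z \<in> dual G" "w \<in> ext_power G 2"
  shows "homologous G len (segment G len y z w) (segment G len x z w - segment G len x y w)"
proof -
  have "boundary 2 (triangle G len x y z w) \<in> bounds21 G len"
    unfolding bounds21_def using triangle_in_chains_R[OF assms] by (rule imageI)
  then show ?thesis by (simp add: homologous_def boundary_triangle algebra_simps)
qed

lemma ray_zero:
  assumes "w \<in> ext_power G 2"
  shows "homologous G len (ray G len 0 w) 0"
  using segment_homologous[of 0 G 0 0 w] assms by simp

text \<open>
  In the triangle with vertices \<open>0\<close>, \<open>\<mu>\<close>, \<open>\<mu> + x\<close> the edge from \<open>\<mu>\<close> to \<open>\<mu> + x\<close> is the same cell of the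
  Jacobian as the segment from \<open>0\<close> to \<open>x\<close>.
\<close>

lemma ray_add_lattice:
  assumes "\<mu> \<in> lattice G len" "x \<in> dual G" "w \<in> ext_power G 2"
  shows "homologous G len (ray G len (x + \<mu>) w) (ray G len x w + ray G len \<mu> w)"
proof -
  have "homologous G len (segment G len \<mu> (\<mu> + x) w) (ray G len (\<mu> + x) w - ray G len \<mu> w)"
    using assms lattice_in_dual by (intro segment_homologous dual_add) auto
  then have "homologous G len (ray G len x w) (ray G len (\<mu> + x) w - ray G len \<mu> w)"
    using segment_translate[OF assms(1), of 0 x w] by simp
  then have "homologous G len (ray G len x w + ray G len \<mu> w)
      (ray G len (\<mu> + x) w - ray G len \<mu> w + ray G len \<mu> w)"
    by (intro homologous_add) auto
  then show ?thesis by (auto simp: add.commute intro: homologous_sym)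
qed

lemma ray_uminus_lattice:
  assumes "\<mu> \<in> lattice G len" "w \<in> ext_power G 2"
  shows "homologous G len (ray G len (- \<mu>) w) (- ray G len \<mu> w)"
proof -
  have "homologous G len (ray G len (- \<mu> + \<mu>) w) (ray G len (- \<mu>) w + ray G len \<mu> w)"
    using assms lattice_uminus lattice_in_dual by (intro ray_add_lattice) blast+
  then have "homologous G len (ray G len (- \<mu>) w + ray G len \<mu> w) 0"
    using homologous_trans[OF homologous_sym ray_zero[OF assms(2)]] by simp
  then show ?thesis by (simp add: homologous_def)
qed

text \<open>
  Modulo boundaries \<open>tensor\<close> is biadditive, and integers move across it. This is what makes it the
  tensor product of \<open>H\<^sub>\<int>\<close> with the coefficients.
\<close>

lemma tensor_add:
  assumes "a \<in> H1_Z G" "a' \<in> H1_Z G" "w \<in> ext_power G 2"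
  shows "homologous G len (tensor G len (a + a') w) (tensor G len a w + tensor G len a' w)"
  unfolding tensor_eq_ray chain_integral_add
  using assms by (intro ray_add_lattice) (auto simp: lattice_def chain_integral_in_dual)

lemma tensor_uminus:
  assumes "a \<in> H1_Z G" "w \<in> ext_power G 2"
  shows "homologous G len (tensor G len (- a) w) (- tensor G len a w)"
  unfolding tensor_eq_ray chain_integral_uminus
  using assms by (intro ray_uminus_lattice) (auto simp: lattice_def)

lemma tensor_int_scale:
  assumes "a \<in> H1_Z G" "w \<in> ext_power G 2" "k \<in> \<int>"
  shows "homologous G len (tensor G len (k *\<^sub>R a) w) (tensor G len a (k *\<^sub>R w))"
proof -
  have nat: "homologous G len (tensor G len (real n *\<^sub>R a) w) (tensor G len a (real n *\<^sub>R w))" for n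
  proof (induction n)
    case 0
    show ?case
      unfolding of_nat_0 scaleR_zero_left tensor_eq_ray chain_integral_0 segment_zero
      by (rule ray_zero[OF assms(2)])
  next
    case (Suc n)
    have eq: "real (Suc n) *\<^sub>R x = real n *\<^sub>R x + x" for x :: "'c::real_vector"
      by (simp add: scaleR_left_distrib)
    have "homologous G len (tensor G len (real n *\<^sub>R a + a) w) (tensor G len (real n *\<^sub>R a) w + tensor G len a w)"
      using assms by (intro tensor_add H1_Z_scale) auto
    also have "homologous G len \<dots> (tensor G len a (real n *\<^sub>R w) + tensor G len a w)"
      by (intro homologous_add Suc homologous_refl)
    also have "\<dots> = tensor G len a (real n *\<^sub>R w + w)"
      by (simp add: tensor_eq_ray segment_add)
    finally show ?case unfolding eq .
  qed
  obtain z where z: "k = of_int z" using \<open>k \<in> \<int>\<close> by (elim Ints_cases)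
  show ?thesis
  proof (cases "z \<ge> 0")
    case True
    then have "k = real (nat z)" by (simp add: z)
    then show ?thesis using nat by metis
  next
    case False
    then have k: "k = - real (nat (- z))" by (simp add: z)
    have "homologous G len (tensor G len (- (real (nat (- z)) *\<^sub>R a)) w)
        (- tensor G len (real (nat (- z)) *\<^sub>R a) w)"
      using assms by (intro tensor_uminus H1_Z_scale) auto
    also have "homologous G len \<dots> (- tensor G len a (real (nat (- z)) *\<^sub>R w))"
      by (intro homologous_uminus nat)
    also have "\<dots> = tensor G len a (- (real (nat (- z)) *\<^sub>R w))"
      by (simp add: tensor_eq_ray segment_uminus)
    finally show ?thesis unfolding k scaleR_minus_left .
  qed
qed

lemma tensor_lincomb:
  assumes "finite I" "\<And>i. i \<in> I \<Longrightarrow> a i \<in> H1_Z G" "\<And>i. i \<in> I \<Longrightarrow> k i \<in> \<int>" "w \<in> ext_power G 2"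
  shows "homologous G len (tensor G len (\<Sum>i\<in>I. k i *\<^sub>R a i) w) (\<Sum>i\<in>I. tensor G len (a i) (k i *\<^sub>R w))"
  using assms(1-3)
proof (induction I rule: finite_induct)
  case empty
  show ?case
    unfolding sum.empty tensor_eq_ray chain_integral_0 by (rule ray_zero[OF assms(4)])
next
  case (insert i I)
  have "homologous G len (tensor G len (k i *\<^sub>R a i + (\<Sum>i\<in>I. k i *\<^sub>R a i)) w)
      (tensor G len (k i *\<^sub>R a i) w + tensor G len (\<Sum>i\<in>I. k i *\<^sub>R a i) w)"
    using insert.prems assms(4) by (intro tensor_add H1_Z_scale H1_Z_sum) auto
  also have "homologous G len \<dots> (tensor G len (a i) (k i *\<^sub>R w) + (\<Sum>i\<in>I. tensor G len (a i) (k i *\<^sub>R w)))"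
    by (intro homologous_add tensor_int_scale insert.IH insert.prems assms(4)) auto
  finally show ?case unfolding sum.insert[OF insert.hyps] .
qed

section \<open>The canonical class of type (1, 1)\<close>

text \<open>
  The canonical class is the identity in \<open>Hom(H\<^sub>\<int>, H\<^sub>\<int>)\<close>, written in the basis of fundamental cycles
  and the dual basis \<open>b\<^sub>\<epsilon>\<close>. Expanding the \<open>b\<^sub>\<epsilon>\<close> of one tree in those of the other and moving the
  integral coefficients to the left factor assembles the fundamental cycles of the other tree.
\<close>

lemma omega_wedge_independent:
  assumes "tropical_curve G len" "is_spanning_tree G F" "is_spanning_tree G F'" "v \<in> dual G"
  shows "homologous G len (omega_wedge G len F v) (omega_wedge G len F' v)"
proof -
  interpret T: spanning_tree_model G len F by unfold_locales (fact assms)+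
  interpret T': spanning_tree_model G len F' by unfold_locales (fact assms)+
  let ?C = "arcs G - F" and ?C' = "arcs G - F'"
  let ?t = "\<lambda>\<epsilon> \<epsilon>'. tensor G len (avec G F \<epsilon>) (avec G F' \<epsilon>' \<epsilon> *\<^sub>R wedge [bvec G \<epsilon>', v])"
  have "wedge [bvec G \<epsilon>, v] = (\<Sum>\<epsilon>'\<in>?C'. avec G F' \<epsilon>' \<epsilon> *\<^sub>R wedge [bvec G \<epsilon>', v])" for \<epsilon>
    by (subst T'.bvec_expansion[of \<epsilon>]) (simp only: wedge_2_sum_left wedge_2_scaleR_left)
  then have "tensor G len a (wedge [bvec G \<epsilon>, v]) =
      (\<Sum>\<epsilon>'\<in>?C'. tensor G len a (avec G F' \<epsilon>' \<epsilon> *\<^sub>R wedge [bvec G \<epsilon>', v]))" for a \<epsilon>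
    unfolding tensor_eq_ray segment_sum[symmetric] by (rule arg_cong)
  then have "omega_wedge G len F v = (\<Sum>\<epsilon>\<in>?C. \<Sum>\<epsilon>'\<in>?C'. ?t \<epsilon> \<epsilon>')"
    unfolding omega_wedge_def by (intro sum.cong refl)
  also have "\<dots> = (\<Sum>\<epsilon>'\<in>?C'. \<Sum>\<epsilon>\<in>?C. ?t \<epsilon> \<epsilon>')" by (rule sum.swap)
  also have "homologous G len \<dots>
      (\<Sum>\<epsilon>'\<in>?C'. tensor G len (\<Sum>\<epsilon>\<in>?C. avec G F' \<epsilon>' \<epsilon> *\<^sub>R avec G F \<epsilon>) (wedge [bvec G \<epsilon>', v]))"
    using assms(4) T'.avec_props(1)
    by (intro homologous_sum homologous_sym[OF tensor_lincomb] T.avec_props wedge_in_ext_power)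
      (auto simp: bvec_in_dual H1_Z_iff)
  also have "\<dots> = omega_wedge G len F' v"
    unfolding omega_wedge_def
    by (intro sum.cong refl arg_cong2[where f = "tensor G len"] T.cycle_expansion[symmetric] T'.avec_props)
  finally show ?thesis .
qed

lemma omega_wedge_diff:
  "omega_wedge G len F (v - v') = omega_wedge G len F v - omega_wedge G len F v'"
  by (simp add: omega_wedge_def tensor_eq_ray wedge_2_diff_right segment_diff sum_subtractf)

text \<open>
  The elements of \<open>omega_H10\<close> may come from different trees; up to boundaries they can be
  rewritten with the same tree before subtracting.
\<close>

lemma add_subgroup_total:
  assumes "tropical_curve G len" "is_spanning_tree G F"
  shows "add_subgroup (bounds21 G len + L21 G len + omega_H10 G len)"
proof -
  let ?J = "bounds21 G len + L21 G len" and ?W = "omega_H10 G len"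
  note J = add_subgroup_bounds21_L21[of G len]
  have BJ: "x \<in> ?J" if "x \<in> bounds21 G len" for x
    using set_plus_intro[OF that L21_zero] by (simp only: add_0_right)
  have "omega_wedge G len F 0 = 0" by (simp add: omega_wedge_def tensor_eq_ray)
  then have "0 \<in> ?W"
    unfolding omega_H10_def using assms(2) dual_0[of G] by (intro CollectI exI[of _ F] exI[of _ 0]) simp
  from set_plus_intro[OF add_subgroup_zero[OF J] this] have "0 \<in> ?J + ?W"
    by (simp only: add_0_left)
  moreover have "x - y \<in> ?J + ?W" if xy: "x \<in> ?J + ?W" "y \<in> ?J + ?W" for x y
  proof -
    obtain j u where x: "x = j + u" "j \<in> ?J" "u \<in> ?W" using xy(1) by (rule set_plus_elim)
    obtain j' u' where y: "y = j' + u'" "j' \<in> ?J" "u' \<in> ?W" using xy(2) by (rule set_plus_elim)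
    from x(3) y(3) obtain F1 v F2 v' where u: "u = omega_wedge G len F1 v" "is_spanning_tree G F1" "v \<in> dual G"
      and u': "u' = omega_wedge G len F2 v'" "is_spanning_tree G F2" "v' \<in> dual G"
      unfolding omega_H10_def by blast
    have h: "omega_wedge G len F1 v' - u' \<in> ?J"
      using omega_wedge_independent[OF assms(1) u(2) u'(2) u'(3)]
      unfolding homologous_def u'(1) by (rule BJ)
    have W: "omega_wedge G len F1 (v - v') \<in> ?W"
      unfolding omega_H10_def using u(2) dual_diff[OF u(3) u'(3)] by blast
    have "x - y = (j - j' + (omega_wedge G len F1 v' - u')) + omega_wedge G len F1 (v - v')"
      unfolding omega_wedge_diff x(1) y(1) u(1) by (simp add: algebra_simps)
    then show ?thesis
      using set_plus_intro[OF add_subgroup_add[OF J add_subgroup_diff[OF J x(2) y(2)] h] W]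
      by (simp only:)
  qed
  ultimately show ?thesis unfolding add_subgroup_def by blast
qed

section \<open>The Ceresa chain\<close>

lemma primitive_of_unit_value:
  assumes "v \<in> dual_Z G" "\<omega> \<in> Omega_Z G" "v \<omega> = 1"
  shows "primitive G v"
  unfolding primitive_def
proof (intro conjI ballI allI impI)
  fix u and k :: nat assume u: "u \<in> dual_Z G" "v = real k *\<^sub>R u"
  then have "u \<omega> \<in> \<int>" using assms(2) by (auto simp: dual_Z_def)
  then obtain z where z: "u \<omega> = of_int z" by (elim Ints_cases)
  have "real k * u \<omega> = 1" using u(2) assms(3) by simp
  then have "of_int (int k * z) = (1::real)" by (simp add: z)
  then have "int k * z = 1" by (simp only: of_int_eq_1_iff)
  then show "k = 1" by (simp add: zmult_eq_1_iff)
qed fact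

text \<open>
  An integral form with value \<open>1\<close> on \<open>v\<close> pins down the direction: a positive multiple \<open>c v\<close> that is
  integral has \<open>c\<close> integral, and if it is primitive then \<open>c = 1\<close>.
\<close>

lemma edge_direction_cell:
  assumes "v \<in> dual_Z G" "\<omega> \<in> Omega_Z G" "v \<omega> = 1" "r > 0"
  shows "edge_direction G (cell G len [x, x + r *\<^sub>R v]) = v"
  unfolding edge_direction_def
proof (rule the_equality)
  have "[x, x + r *\<^sub>R v] \<in> cell G len [x, x + r *\<^sub>R v]"
    unfolding cell_def using lattice_0[of G len] by force
  then show "primitive G v \<and> (\<exists>xs\<in>cell G len [x, x + r *\<^sub>R v]. \<exists>r>0. xs ! 1 - xs ! 0 = r *\<^sub>R v)"
    using primitive_of_unit_value[OF assms(1-3)] assms(4) by force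
next
  fix v' assume v': "primitive G v' \<and> (\<exists>xs\<in>cell G len [x, x + r *\<^sub>R v]. \<exists>r>0. xs ! 1 - xs ! 0 = r *\<^sub>R v')"
  then obtain s where s: "s > 0" "r *\<^sub>R v = s *\<^sub>R v'"
    by (auto simp: cell_def)
  define c where "c = r / s"
  have c: "c > 0" "v' = c *\<^sub>R v"
  proof -
    have "v' = (1 / s) *\<^sub>R (s *\<^sub>R v')" using s(1) by simp
    then show "v' = c *\<^sub>R v" unfolding s(2)[symmetric] by (simp add: c_def)
  qed (use s(1) assms(4) in \<open>simp add: c_def\<close>)
  have "v' \<omega> \<in> \<int>" using v' assms(2) by (auto simp: primitive_def dual_Z_def)
  then have "c \<in> \<int>" using c(2) assms(3) by simp
  then obtain k where "c = real k" using c(1) by (metis Ints_cases of_int_of_nat_eq zero_less_imp_eq_int of_int_0_less_iff)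
  moreover from this have "k = 1" using v' c(2) assms(1) unfolding primitive_def by blast
  ultimately show "v' = v" using c(2) by simp
qed

lemma map_uminus_cell: "map uminus ` cell G len xs = cell G len (map uminus xs)"
proof -
  have eq: "map uminus (map ((+) \<mu>) xs) = map ((+) (- \<mu>)) (map uminus xs)" for \<mu>
    by simp
  show ?thesis
  proof (intro equalityI subsetI)
    fix ys assume "ys \<in> map uminus ` cell G len xs"
    then obtain \<mu> where \<mu>: "\<mu> \<in> lattice G len" "ys = map uminus (map ((+) \<mu>) xs)"
      by (auto simp: cell_def)
    then show "ys \<in> cell G len (map uminus xs)"
      unfolding cell_def eq using lattice_uminus[OF \<mu>(1)] by blast
  next
    fix ys assume "ys \<in> cell G len (map uminus xs)"
    then obtain \<mu> where \<mu>: "\<mu> \<in> lattice G len" "ys = map ((+) \<mu>) (map uminus xs)"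
      by (auto simp: cell_def)
    then have "ys = map uminus (map ((+) (- \<mu>)) xs)" unfolding eq by simp
    then show "ys \<in> map uminus ` cell G len xs"
      unfolding cell_def using lattice_uminus[OF \<mu>(1)] by blast
  qed
qed

text \<open>
  Both chosen points lie on the segment, so their difference is parallel to the coefficient. For
  this reason the fundamental chain of a tropical curve is blind to the choice of points.
\<close>

lemma point_homotopy_parallel:
  assumes "cell_points G len pt" "cell_points G len pt'" "x \<in> dual G" "v \<in> dual G"
  shows "point_homotopy pt pt' (segment G len x (x + r *\<^sub>R v) (wedge [v])) = 0"
proof -
  let ?xs = "[x, x + r *\<^sub>R v]"
  have xs: "set ?xs \<subseteq> dual G" using assms(3,4) by (simp add: dual_add dual_scale)
  have on_segment: "\<exists>s. p ?xs = x + s *\<^sub>R v" if "cell_points G len p" for p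
  proof -
    have "p ?xs \<in> convex hull {x, x + r *\<^sub>R v}"
      using that xs unfolding cell_points_def by (metis list.distinct(1) list.simps(15) empty_set)
    then obtain a b where "a + b = 1" "p ?xs = a *\<^sub>R x + b *\<^sub>R (x + r *\<^sub>R v)"
      by (auto simp: convex_hull_2)
    then have "p ?xs = x + (b * r) *\<^sub>R v"
      by (simp add: scaleR_add_right flip: scaleR_left_distrib add.assoc)
    then show ?thesis by blast
  qed
  obtain s s' where "pt ?xs = x + s *\<^sub>R v" "pt' ?xs = x + s' *\<^sub>R v"
    using on_segment[OF assms(1)] on_segment[OF assms(2)] by blast
  then have "pt ?xs - pt' ?xs = (s - s') *\<^sub>R v" by (simp add: scaleR_left_diff_distrib)
  then have "vwedge (pt ?xs - pt' ?xs) (wedge [v]) = 0"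
    by (simp add: vwedge_wedge wedge_2_scaleR_left)
  then show ?thesis
    unfolding segment_def by (subst point_homotopy_single[OF assms(1,2) _ xs]) simp_all
qed

context tropical_model
begin

lemma edge_direction_arc:
  assumes "e \<in> arcs G"
  shows "edge_direction G (cell G len [x, x + len e *\<^sub>R bvec G e]) = bvec G e"
    and "edge_direction G (cell G len [x, x - len e *\<^sub>R bvec G e]) = - bvec G e"
proof -
  obtain \<omega> where \<omega>: "\<omega> \<in> Omega_Z G" "\<omega> e = 1" using harmonic_form_through_arc assms by blast
  show "edge_direction G (cell G len [x, x + len e *\<^sub>R bvec G e]) = bvec G e"
    using \<omega> len_pos assms
    by (intro edge_direction_cell[where \<omega> = \<omega>]) (auto simp: bvec_in_dual_Z bvec_apply)
  have neg: "- \<omega> \<in> Omega_Z G" using \<omega>(1) H1_Z_uminus by (simp add: Omega_Z_eq_H1_Z)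
  moreover have "- bvec G e \<in> dual_Z G"
    using bvec_in_dual_Z[of G e] dual_uminus by (auto simp: dual_Z_def)
  moreover have "(- bvec G e) (- \<omega>) = 1" using bvec_apply[OF neg, of e] \<omega>(2) by simp
  ultimately have "edge_direction G (cell G len [x, x + len e *\<^sub>R - bvec G e]) = - bvec G e"
    using len_pos assms by (intro edge_direction_cell)
  then show "edge_direction G (cell G len [x, x - len e *\<^sub>R bvec G e]) = - bvec G e"
    by simp
qed

lemma path_integral_eq:
  assumes "fst ` set p \<subseteq> arcs G"
  shows "path_integral G len (e\<^sub>0, t\<^sub>0) p (e, t) =
    - (t\<^sub>0 *\<^sub>R bvec G e\<^sub>0) + chain_integral G len (walk_chain p) + t *\<^sub>R bvec G e"
proof -
  have "(\<Sum>(e', d)\<leftarrow>p. (if d then 1 else -1) * len e' * \<omega> e') = (\<Sum>x\<in>arcs G. walk_chain p x * len x * \<omega> x)" for \<omega>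
    using assms
  proof (induction p)
    case Nil
    then show ?case by simp
  next
    case (Cons ed p)
    obtain e' d where ed: "ed = (e', d)" by fastforce
    have "(\<Sum>x\<in>arcs G. walk_chain (ed # p) x * len x * \<omega> x)
        = (\<Sum>x\<in>arcs G. if x = e' then (if d then 1 else -1) * len x * \<omega> x else 0)
          + (\<Sum>x\<in>arcs G. walk_chain p x * len x * \<omega> x)"
      unfolding sum.distrib[symmetric] by (intro sum.cong) (auto simp: ed algebra_simps)
    then show ?case using Cons by (simp add: ed sum.delta)
  qed
  then show ?thesis
    by (auto simp: fun_eq_iff on_Omega_def bvec_def chain_integral_def)
qed

end

context spanning_tree_model
begin

text \<open>
  Adding this vector to \<open>position\<close> gives the lift of the Abel-Jacobi map that sends the base point
  to \<open>0\<close>.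
\<close>

definition base_shift :: "'e \<times> real \<Rightarrow> 'e covec" where
  "base_shift b = - (snd b *\<^sub>R bvec G (fst b)) - position (tail G (fst b))"

lemma base_shift_in_dual: "base_shift b \<in> dual G"
  unfolding base_shift_def by (intro dual_diff dual_uminus dual_scale bvec_in_dual position_in_dual)

lemma aj_edge_eq:
  fixes e\<^sub>0 :: 'e and t\<^sub>0 :: real
  assumes "e\<^sub>0 \<in> arcs G" "e \<in> arcs G"
  defines "x \<equiv> base_shift (e\<^sub>0, t\<^sub>0) + position (tail G e)"
  shows "aj_edge G len (e\<^sub>0, t\<^sub>0) e = cell G len [x, x + len e *\<^sub>R bvec G e]"
proof -
  let ?P = "\<lambda>p. uwalk G (tail G e\<^sub>0) p (tail G e)" and ?b = "bvec G e"
  let ?I = "\<lambda>p. chain_integral G len (walk_chain p)"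
  let ?d = "position (tail G e) - position (tail G e\<^sub>0)"
  let ?f = "\<lambda>y. [- (t\<^sub>0 *\<^sub>R bvec G e\<^sub>0) + y, - (t\<^sub>0 *\<^sub>R bvec G e\<^sub>0) + y + len e *\<^sub>R ?b]"
  have "[path_integral G len (e\<^sub>0, t\<^sub>0) p (e, 0), path_integral G len (e\<^sub>0, t\<^sub>0) p (e, len e)] = ?f (?I p)"
    if "?P p" for p
    using path_integral_eq[OF uwalk_arcs[OF that]] by (simp del: path_integral.simps)
  then have "aj_edge G len (e\<^sub>0, t\<^sub>0) e = (\<lambda>p. ?f (?I p)) ` {p. ?P p}"
    unfolding aj_edge_def setcompr_eq_image fst_conv by (intro image_cong refl) blast
  also have "\<dots> = ?f ` {?I p | p. ?P p}"
    unfolding setcompr_eq_image image_image ..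
  also have "{?I p | p. ?P p} = {?d + \<mu> | \<mu>. \<mu> \<in> lattice G len}"
    using assms by (intro chain_integral_walks) auto
  also have "?f ` \<dots> = cell G len [x, x + len e *\<^sub>R ?b]"
    unfolding cell_def setcompr_eq_image image_image
    by (intro image_cong refl) (simp add: x_def base_shift_def algebra_simps)
  finally show ?thesis .
qed

lemma ceresa_chain_eq:
  fixes e\<^sub>0 :: 'e and t\<^sub>0 :: real
  assumes "e\<^sub>0 \<in> arcs G"
  defines "x \<equiv> \<lambda>v. base_shift (e\<^sub>0, t\<^sub>0) + position v"
  shows "ceresa_chain G len (e\<^sub>0, t\<^sub>0) =
    (\<Sum>e\<in>arcs G. segment G len (x (tail G e)) (x (tail G e) + len e *\<^sub>R bvec G e) (wedge [bvec G e])
      + segment G len (- x (tail G e)) (- x (tail G e) + (- len e) *\<^sub>R bvec G e) (wedge [bvec G e]))"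
  unfolding ceresa_chain_def fundamental_chain_def sum_subtractf[symmetric]
proof (intro sum.cong refl)
  fix e assume e: "e \<in> arcs G"
  let ?x = "x (tail G e)"
  have plus: "aj_edge G len (e\<^sub>0, t\<^sub>0) e = cell G len [?x, ?x + len e *\<^sub>R bvec G e]"
    unfolding x_def by (rule aj_edge_eq[OF assms(1) e])
  have minus: "aj_edge_minus G len (e\<^sub>0, t\<^sub>0) e = cell G len [- ?x, - ?x - len e *\<^sub>R bvec G e]"
    unfolding aj_edge_minus_def plus map_uminus_cell by simp
  show "Poly_Mapping.single (aj_edge G len (e\<^sub>0, t\<^sub>0) e) (wedge [edge_direction G (aj_edge G len (e\<^sub>0, t\<^sub>0) e)])
      - Poly_Mapping.single (aj_edge_minus G len (e\<^sub>0, t\<^sub>0) e) (wedge [edge_direction G (aj_edge_minus G len (e\<^sub>0, t\<^sub>0) e)])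
    = segment G len ?x (?x + len e *\<^sub>R bvec G e) (wedge [bvec G e])
      + segment G len (- ?x) (- ?x + (- len e) *\<^sub>R bvec G e) (wedge [bvec G e])"
    unfolding plus minus edge_direction_arc[OF e] by (simp add: segment_def wedge_1_uminus single_uminus)
qed

end

section \<open>A chain bounded by the Ceresa cycle\<close>

text \<open>
  The filling over one edge with lift from \<open>x\<close> to \<open>y = h + \<mu>\<close>, where \<open>h\<close> is the lift of its head and
  \<open>\<mu>\<close> its period. The first two triangles are the cones from the origin over the edge and over its
  mirror image. The next two carry their free sides \<open>0, y\<close> and \<open>0, - y\<close> back to \<open>0, h\<close> and \<open>0, - h\<close>,
  at the price of the loops of \<open>\<mu>\<close> and \<open>- \<mu>\<close>. The last two show that these loops cancel; the
  degenerate triangle at the origin has the constant segment as its boundary.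
\<close>

definition edge_filling ::
  "('v, 'e) pre_digraph \<Rightarrow> ('e \<Rightarrow> real) \<Rightarrow> 'e covec \<Rightarrow> 'e covec \<Rightarrow> 'e covec \<Rightarrow> 'e covec \<Rightarrow> 'e chain"
where
  "edge_filling G len x y \<mu> b =
    triangle G len 0 x y (wedge [b]) + triangle G len 0 (- x) (- y) (wedge [b])
    - triangle G len 0 \<mu> y (wedge [b]) - triangle G len 0 (- \<mu>) (- y) (wedge [b])
    + triangle G len 0 \<mu> 0 (wedge [b]) + triangle G len 0 0 0 (wedge [b])"

lemma edge_filling_in_chains_Z:
  assumes "x \<in> dual G" "y \<in> dual G" "\<mu> \<in> dual G" "b \<in> dual_Z G"
  shows "edge_filling G len x y \<mu> b \<in> chains_Z G len 1 2"
proof -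
  have "wedge [b] \<in> ext_power_Z G 1" using assms(4) by (intro wedge_in_ext_power_Z) auto
  then show ?thesis
    unfolding edge_filling_def using assms(1-3)
    by (intro add_subgroup_add add_subgroup_diff add_subgroup_chains_Z triangle_in_chains_Z
        dual_uminus dual_0)
qed

text \<open>
  The defect depends only on the lifts of the two ends of the edge, hence it telescopes in the sum
  over all edges.
\<close>

lemma boundary_edge_filling:
  assumes "\<mu> \<in> lattice G len" "y = h + \<mu>"
  shows "boundary 2 (edge_filling G len x y \<mu> b) =
    segment G len x y (wedge [b]) + segment G len (- x) (- y) (wedge [b])
    + ((ray G len x (wedge [b]) + ray G len (- x) (wedge [b]))
      - (ray G len h (wedge [b]) + ray G len (- h) (wedge [b])))"
proof -
  have "segment G len \<mu> y w = ray G len h w" for w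
    using segment_translate[OF assms(1), of 0 h w] by (simp add: assms(2) add.commute)
  moreover have "segment G len (- \<mu>) (- y) w = ray G len (- h) w" for w
    using segment_translate[OF lattice_uminus[OF assms(1)], of 0 "- h" w]
    by (simp add: assms(2) add.commute)
  moreover have "segment G len \<mu> 0 w = ray G len (- \<mu>) w" for w
    using segment_translate[OF assms(1), of 0 "- \<mu>" w] by simp
  ultimately show ?thesis
    unfolding edge_filling_def
    by (simp add: additive.add[OF additive_boundary] additive.diff[OF additive_boundary] boundary_triangle)
qed

text \<open>
  Each triangle contributes its side opposite the first vertex. After passing to segments from the
  origin there remain a difference of two terms attached to the ends of the edge and multiples of
  the loop of \<open>\<mu>\<close> with total coefficient \<open>(\<mu> - 2 x) \<and> b\<close>. Since \<open>\<mu> = x + r b - h\<close>, this is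
  \<open>b \<and> (x + h)\<close>.
\<close>

lemma monodromy_edge_filling:
  assumes \<mu>: "\<mu> \<in> lattice G len" and y: "y = h + \<mu>" "y = x + r *\<^sub>R b"
    and dual: "x \<in> dual G" "h \<in> dual G" "b \<in> dual G"
  shows "homologous G len (monodromy hd 2 (edge_filling G len x y \<mu> b))
    (((ray G len x (wedge [x, b]) - ray G len (- x) (wedge [x, b]))
      - (ray G len h (wedge [h, b]) - ray G len (- h) (wedge [h, b])))
    + ray G len \<mu> (wedge [b, x + h]))"
proof -
  have \<mu>': "\<mu> \<in> dual G" using \<mu> by (rule lattice_in_dual)
  have y': "y \<in> dual G" using dual \<mu>' by (simp add: y(1) dual_add)
  \<comment> \<open>All coefficients that occur are combinations of the following two.\<close>
  define w where "w = wedge [x, b]"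
  define m where "m = wedge [\<mu>, b]"
  have wh: "wedge [h, b] = w - m"
  proof -
    have "wedge [x, b] = wedge [y, b]" by (simp add: y(2) wedge_2_add_left wedge_2_scaleR_left)
    then show ?thesis by (simp add: y(1) w_def m_def wedge_2_add_left)
  qed
  have wb: "wedge [b, x + h] = m - w - w"
    using wedge_2_swap[of b "x + h"] wh by (simp add: wedge_2_add_left w_def)
  have ext: "w \<in> ext_power G 2" "m \<in> ext_power G 2"
    unfolding w_def m_def by (intro wedge_2_in_ext_power dual \<mu>')+
  have translate: "segment G len \<mu> y v = ray G len h v"
    "segment G len (- \<mu>) (- y) v = ray G len (- h) v"
    "segment G len \<mu> 0 v = ray G len (- \<mu>) v" for v
    using segment_translate[OF \<mu>, of 0 h v] segment_translate[OF lattice_uminus[OF \<mu>], of 0 "- h" v]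
      segment_translate[OF \<mu>, of 0 "- \<mu>" v] by (simp_all add: y(1) add.commute)
  have N: "monodromy hd 2 (edge_filling G len x y \<mu> b) =
      - segment G len x y w + segment G len (- x) (- y) w
      + ray G len h m - ray G len (- h) m - ray G len (- \<mu>) m"
    unfolding edge_filling_def additive.add[OF additive_monodromy] additive.diff[OF additive_monodromy]
    using dual \<mu>' y'
    by (simp add: monodromy_hd_triangle dual_uminus vwedge_wedge translate wedge_2_uminus_left
        segment_uminus flip: w_def m_def)
  have xy: "homologous G len (segment G len x y w) (ray G len y w - ray G len x w)"
    using dual y' ext by (intro segment_homologous) auto
  have y_ray: "homologous G len (ray G len y w) (ray G len h w + ray G len \<mu> w)"
    unfolding y(1) using \<mu> dual ext by (intro ray_add_lattice)
  have xy_neg: "homologous G len (segment G len (- x) (- y) w) (ray G len (- y) w - ray G len (- x) w)"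
    using dual y' ext by (intro segment_homologous) (auto intro: dual_uminus)
  have "homologous G len (ray G len (- h + - \<mu>) w) (ray G len (- h) w + ray G len (- \<mu>) w)"
    using lattice_uminus[OF \<mu>] dual ext by (intro ray_add_lattice dual_uminus)
  then have y_ray_neg: "homologous G len (ray G len (- y) w) (ray G len (- h) w + ray G len (- \<mu>) w)"
    by (simp add: y(1))
  note neg = ray_uminus_lattice[OF \<mu> ext(1)] ray_uminus_lattice[OF \<mu> ext(2)]
  have "homologous G len (- segment G len x y w) (- (ray G len h w + ray G len \<mu> w - ray G len x w))"
    by (intro homologous_uminus homologous_trans[OF xy] homologous_diff y_ray homologous_refl)
  moreover have "homologous G len (segment G len (- x) (- y) w)
      (ray G len (- h) w + - ray G len \<mu> w - ray G len (- x) w)"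
    by (intro homologous_trans[OF xy_neg] homologous_diff homologous_trans[OF y_ray_neg]
        homologous_add neg homologous_refl)
  ultimately have "homologous G len (monodromy hd 2 (edge_filling G len x y \<mu> b))
      (- (ray G len h w + ray G len \<mu> w - ray G len x w)
       + (ray G len (- h) w + - ray G len \<mu> w - ray G len (- x) w)
       + ray G len h m - ray G len (- h) m - - ray G len \<mu> m)"
    unfolding N by (intro homologous_diff homologous_add neg homologous_refl)
  also have "\<dots> = ((ray G len x w - ray G len (- x) w)
      - (ray G len h (w - m) - ray G len (- h) (w - m))) + ray G len \<mu> (m - w - w)"
    unfolding segment_diff by simp
  finally show ?thesis unfolding wh wb by (simp only: w_def)
qed

context spanning_tree_model
begin

definition ceresa_filling :: "'e covec \<Rightarrow> 'e chain" where
  "ceresa_filling c = (\<Sum>e\<in>arcs G. edge_filling G len (c + position (tail G e))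
     (c + position (tail G e) + len e *\<^sub>R bvec G e) (period e) (bvec G e))"

lemma translated_step:
  assumes "e \<in> arcs G"
  shows "c + position (tail G e) + len e *\<^sub>R bvec G e = (c + position (head G e)) + period e"
  unfolding add.assoc position_step[OF assms] ..

lemma ceresa_filling_in_chains_Z: "c \<in> dual G \<Longrightarrow> ceresa_filling c \<in> chains_Z G len 1 2"
  unfolding ceresa_filling_def
  by (intro add_subgroup_sum add_subgroup_chains_Z edge_filling_in_chains_Z bvec_in_dual_Z
      dual_add dual_scale bvec_in_dual position_in_dual lattice_in_dual[OF period_in_lattice])

lemma boundary_ceresa_filling:
  "boundary 2 (ceresa_filling c) =
    (\<Sum>e\<in>arcs G. segment G len (c + position (tail G e)) (c + position (tail G e) + len e *\<^sub>R bvec G e) (wedge [bvec G e])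
      + segment G len (- (c + position (tail G e))) (- (c + position (tail G e)) + (- len e) *\<^sub>R bvec G e) (wedge [bvec G e]))"
proof -
  let ?f = "\<lambda>v b. ray G len (c + position v) (wedge [b]) + ray G len (- (c + position v)) (wedge [b])"
  have "boundary 2 (ceresa_filling c) = (\<Sum>e\<in>arcs G.
      (segment G len (c + position (tail G e)) (c + position (tail G e) + len e *\<^sub>R bvec G e) (wedge [bvec G e])
      + segment G len (- (c + position (tail G e))) (- (c + position (tail G e)) + (- len e) *\<^sub>R bvec G e) (wedge [bvec G e]))
      + (?f (tail G e) (bvec G e) - ?f (head G e) (bvec G e)))"
    unfolding ceresa_filling_def additive.sum[OF additive_boundary]
    by (intro sum.cong refl, subst boundary_edge_filling[OF period_in_lattice translated_step]) simp_all
  moreover have "(\<Sum>e\<in>arcs G. ?f (tail G e) (bvec G e) - ?f (head G e) (bvec G e)) = 0"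
    by (rule sum_arcs_telescope) (simp only: wedge_1_add segment_add add_ac)
  ultimately show ?thesis by (simp only: sum.distrib add_0_right)
qed

text \<open>
  The terms attached to the ends of the edges cancel at every vertex, and tree edges have period
  \<open>0\<close>. There remain the loops of the edges \<open>\<epsilon>\<close> outside the tree, with \<open>b\<^sub>\<epsilon>\<close> wedged with the sum of the
  lifts of the two ends of \<open>\<epsilon>\<close>. By the normalisation of \<open>position\<close> this sum is the wanted signed sum
  over the tree, up to twice the shift \<open>c\<close>, which is the same for all \<open>\<epsilon>\<close>.
\<close>

lemma monodromy_ceresa_filling:
  assumes c: "c \<in> dual G"
  shows "homologous G len (monodromy hd 2 (ceresa_filling c))
    ((\<Sum>e\<in>F. \<Sum>\<epsilon>\<in>arcs G - F.
         tensor G len (avec G F \<epsilon>)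
           ((tree_sgn G F e \<epsilon> * len e) *\<^sub>R wedge [bvec G \<epsilon>, bvec G e]))
     + omega_wedge G len F (2 *\<^sub>R c))"
proof -
  let ?f = "\<lambda>v b. ray G len (c + position v) (wedge [c + position v, b])
    - ray G len (- (c + position v)) (wedge [c + position v, b])"
  let ?s = "\<lambda>e. (c + position (tail G e)) + (c + position (head G e))"
  have dual: "c + position v \<in> dual G" for v using c by (intro dual_add position_in_dual)
  have "homologous G len (monodromy hd 2 (ceresa_filling c))
      (\<Sum>e\<in>arcs G. (?f (tail G e) (bvec G e) - ?f (head G e) (bvec G e))
        + ray G len (period e) (wedge [bvec G e, ?s e]))"
    unfolding ceresa_filling_def additive.sum[OF additive_monodromy]
    by (intro homologous_sum
        monodromy_edge_filling[OF period_in_lattice translated_step refl dual dual bvec_in_dual])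
  also have "(\<Sum>e\<in>arcs G. (?f (tail G e) (bvec G e) - ?f (head G e) (bvec G e))
        + ray G len (period e) (wedge [bvec G e, ?s e]))
      = (\<Sum>e\<in>arcs G. ray G len (period e) (wedge [bvec G e, ?s e]))"
  proof -
    have "(\<Sum>e\<in>arcs G. ?f (tail G e) (bvec G e) - ?f (head G e) (bvec G e)) = 0"
      by (rule sum_arcs_telescope, unfold wedge_2_add_right segment_add, rule add_diff_add)
    then show ?thesis by (simp only: sum.distrib add_0_left)
  qed
  also have "\<dots> = (\<Sum>e\<in>F. ray G len (period e) (wedge [bvec G e, ?s e]))
      + (\<Sum>\<epsilon>\<in>arcs G - F. ray G len (period \<epsilon>) (wedge [bvec G \<epsilon>, ?s \<epsilon>]))"
    using sum.subset_diff[OF F_subset finite_arcs] by (simp add: add.commute)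
  also have "homologous G len \<dots>
      ((\<Sum>e\<in>F. 0) + (\<Sum>\<epsilon>\<in>arcs G - F. ray G len (period \<epsilon>) (wedge [bvec G \<epsilon>, ?s \<epsilon>])))"
  proof (intro homologous_add homologous_sum homologous_refl)
    fix e assume "e \<in> F"
    then have "period e = 0" by (simp add: period_def fundamental_cycle_def)
    moreover have "wedge [bvec G e, ?s e] \<in> ext_power G 2"
      by (intro wedge_2_in_ext_power bvec_in_dual dual_add[OF dual dual])
    ultimately show "homologous G len (ray G len (period e) (wedge [bvec G e, ?s e])) 0"
      by (simp only: ray_zero)
  qed
  also have "(\<Sum>e\<in>F. 0) + (\<Sum>\<epsilon>\<in>arcs G - F. ray G len (period \<epsilon>) (wedge [bvec G \<epsilon>, ?s \<epsilon>]))
      = (\<Sum>\<epsilon>\<in>arcs G - F. (\<Sum>e\<in>F. tensor G len (avec G F \<epsilon>)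
           ((tree_sgn G F e \<epsilon> * len e) *\<^sub>R wedge [bvec G \<epsilon>, bvec G e]))
         + tensor G len (avec G F \<epsilon>) (wedge [bvec G \<epsilon>, 2 *\<^sub>R c]))"
    unfolding sum.neutral_const add_0_left
  proof (intro sum.cong refl)
    fix \<epsilon> assume \<epsilon>: "\<epsilon> \<in> arcs G - F"
    have "?s \<epsilon> = (position (tail G \<epsilon>) + position (head G \<epsilon>)) + 2 *\<^sub>R c"
      by (simp add: scaleR_2)
    also have "position (tail G \<epsilon>) + position (head G \<epsilon>) = (\<Sum>e\<in>F. (tree_sgn G F e \<epsilon> * len e) *\<^sub>R bvec G e)"
      unfolding position_def sum.distrib[symmetric]
    proof (intro sum.cong refl)
      fix e assume "e \<in> F"
      then have "tree_sgn G F e \<epsilon> * len e = len e * side e (tail G \<epsilon>) / 2 + len e * side e (head G \<epsilon>) / 2"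
        by (simp add: tree_sgn_eq[OF _ \<epsilon>] field_simps)
      then show "(len e * side e (tail G \<epsilon>) / 2) *\<^sub>R bvec G e + (len e * side e (head G \<epsilon>) / 2) *\<^sub>R bvec G e
          = (tree_sgn G F e \<epsilon> * len e) *\<^sub>R bvec G e"
        by (simp only: scaleR_left_distrib)
    qed
    finally have s: "?s \<epsilon> = (\<Sum>e\<in>F. (tree_sgn G F e \<epsilon> * len e) *\<^sub>R bvec G e) + 2 *\<^sub>R c" .
    have "period \<epsilon> = chain_integral G len (avec G F \<epsilon>)" using \<epsilon> by (simp add: period_def fundamental_cycle_def)
    then show "ray G len (period \<epsilon>) (wedge [bvec G \<epsilon>, ?s \<epsilon>]) = (\<Sum>e\<in>F. tensor G len (avec G F \<epsilon>)
           ((tree_sgn G F e \<epsilon> * len e) *\<^sub>R wedge [bvec G \<epsilon>, bvec G e]))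
         + tensor G len (avec G F \<epsilon>) (wedge [bvec G \<epsilon>, 2 *\<^sub>R c])"
      unfolding s tensor_eq_ray
      by (simp only: wedge_2_add_right wedge_2_sum_right wedge_2_scaleR_right segment_add segment_sum)
  qed
  also have "\<dots> = (\<Sum>e\<in>F. \<Sum>\<epsilon>\<in>arcs G - F. tensor G len (avec G F \<epsilon>)
           ((tree_sgn G F e \<epsilon> * len e) *\<^sub>R wedge [bvec G \<epsilon>, bvec G e]))
     + omega_wedge G len F (2 *\<^sub>R c)"
    unfolding sum.distrib omega_wedge_def by (subst sum.swap) (rule refl)
  finally show ?thesis .
qed

section \<open>The Ceresa class\<close>

lemma JH_class_eqI: "c - d \<in> bounds21 G len + L21 G len \<Longrightarrow> JH_class G len c = JH_class G len d"
  by (simp add: JH_class_def elt_set_plus_eq_iff[OF add_subgroup_bounds21_L21])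

text \<open>
  Two integral chains bounded by the Ceresa cycle differ by an integral cycle, which contributes an
  element of \<open>L21\<close>. A change of the chosen points contributes a boundary, since the homotopy between
  the two choices vanishes on the Ceresa cycle.
\<close>

lemma pointed_ceresa_class_eq:
  fixes e\<^sub>0 :: 'e and t\<^sub>0 :: real
  assumes e0: "e\<^sub>0 \<in> arcs G"
  defines "c \<equiv> base_shift (e\<^sub>0, t\<^sub>0)"
  shows "pointed_ceresa_class G len (e\<^sub>0, t\<^sub>0) = JH_class G len (monodromy hd 2 (ceresa_filling c))"
  unfolding pointed_ceresa_class_def
proof (rule the_equality)
  have c: "c \<in> dual G"
    unfolding c_def by (rule base_shift_in_dual)
  note filling = ceresa_filling_in_chains_Z[OF c]
  have ceresa: "ceresa_chain G len (e\<^sub>0, t\<^sub>0) = boundary 2 (ceresa_filling c)"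
    unfolding boundary_ceresa_filling c_def by (rule ceresa_chain_eq[OF e0])
  then show "\<exists>pt \<xi>. cell_points G len pt \<and> \<xi> \<in> chains_Z G len 1 2 \<and>
      boundary 2 \<xi> = ceresa_chain G len (e\<^sub>0, t\<^sub>0) \<and>
      JH_class G len (monodromy hd 2 (ceresa_filling c)) = JH_class G len (monodromy pt 2 \<xi>)"
    using cell_points_hd filling by metis
  fix C assume "\<exists>pt \<xi>. cell_points G len pt \<and> \<xi> \<in> chains_Z G len 1 2 \<and>
      boundary 2 \<xi> = ceresa_chain G len (e\<^sub>0, t\<^sub>0) \<and> C = JH_class G len (monodromy pt 2 \<xi>)"
  then obtain pt \<xi> where pt: "cell_points G len pt" and \<xi>: "\<xi> \<in> chains_Z G len 1 2"
    "boundary 2 \<xi> = ceresa_chain G len (e\<^sub>0, t\<^sub>0)" and C: "C = JH_class G len (monodromy pt 2 \<xi>)"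
    by blast
  have dual: "c + position v \<in> dual G" for v using c by (intro dual_add position_in_dual)
  have "point_homotopy pt hd (boundary 2 \<xi>) = 0"
    unfolding \<xi>(2) ceresa boundary_ceresa_filling
      additive.sum[OF additive_point_homotopy] additive.add[OF additive_point_homotopy]
    by (intro sum.neutral ballI)
      (simp only: point_homotopy_parallel[OF pt cell_points_hd dual bvec_in_dual]
        point_homotopy_parallel[OF pt cell_points_hd dual_uminus[OF dual] bvec_in_dual] add_0_left)
  then have B: "monodromy pt 2 \<xi> - monodromy hd 2 \<xi> \<in> bounds21 G len"
    by (intro monodromy_independent pt cell_points_hd \<xi>)
  have "boundary 2 (\<xi> - ceresa_filling c) = 0"
    by (simp add: additive.diff[OF additive_boundary] \<xi>(2) ceresa)
  then have L: "monodromy hd 2 (\<xi> - ceresa_filling c) \<in> L21 G len"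
    using cell_points_hd add_subgroup_diff[OF add_subgroup_chains_Z \<xi>(1) filling]
    unfolding L21_def by blast
  have "monodromy pt 2 \<xi> - monodromy hd 2 (ceresa_filling c)
      = (monodromy pt 2 \<xi> - monodromy hd 2 \<xi>) + monodromy hd 2 (\<xi> - ceresa_filling c)"
    unfolding additive.diff[OF additive_monodromy] by simp
  also have "\<dots> \<in> bounds21 G len + L21 G len" using B L by (rule set_plus_intro)
  finally show "C = JH_class G len (monodromy hd 2 (ceresa_filling c))"
    unfolding C by (rule JH_class_eqI)
qed

end

theorem theorem6p8:
  fixes G :: "('v, 'e) pre_digraph" and len :: "'e \<Rightarrow> real" and F :: "'e set"
  assumes "tropical_curve G len"
    and "is_spanning_tree G F"
  shows "unpointed_ceresa_class G len =
    JHbar_class G len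
      (\<Sum>e\<in>F. \<Sum>\<epsilon>\<in>arcs G - F.
         tensor G len (avec G F \<epsilon>)
           ((tree_sgn G F e \<epsilon> * len e) *\<^sub>R wedge [bvec G \<epsilon>, bvec G e]))"
    (is "_ = JHbar_class G len ?S")
proof -
  interpret spanning_tree_model G len F by unfold_locales (fact assms)+
  let ?J = "bounds21 G len + L21 G len" and ?W = "omega_H10 G len"
  note M = add_subgroup_total[OF assms]
  have class_eq: "pointed_ceresa_class G len b + ?W = JHbar_class G len ?S"
    if b: "b \<in> curve_points G len" for b
  proof -
    obtain e\<^sub>0 t\<^sub>0 where e0: "b = (e\<^sub>0, t\<^sub>0)" "e\<^sub>0 \<in> arcs G"
      using b by (auto simp: curve_points_def)
    \<comment> \<open>The base point enters only through this shift, which the quotient by \<open>omega_H10\<close> absorbs.\<close>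
    define c where "c = base_shift b"
    have c: "c \<in> dual G"
      unfolding c_def by (rule base_shift_in_dual)
    let ?N = "monodromy hd 2 (ceresa_filling c)" and ?w = "omega_wedge G len F (2 *\<^sub>R c)"
    have "?N - (?S + ?w) \<in> bounds21 G len"
      using monodromy_ceresa_filling[OF c] by (simp only: homologous_def)
    from set_plus_intro[OF this L21_zero] have J: "?N - (?S + ?w) \<in> ?J" by (simp only: add_0_right)
    have w: "?w \<in> ?W"
      unfolding omega_H10_def using assms(2) dual_scale[OF c] by blast
    have "?N - ?S = (?N - (?S + ?w)) + ?w" by simp
    also have "\<dots> \<in> ?J + ?W" using J w by (rule set_plus_intro)
    finally have "?N +o (?J + ?W) = ?S +o (?J + ?W)" by (simp only: elt_set_plus_eq_iff[OF M])
    then show ?thesis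
      unfolding e0(1) pointed_ceresa_class_eq[OF e0(2)] c_def JH_class_def JHbar_class_def
        set_plus_rearrange3 .
  qed
  have "arcs G \<noteq> {}"
  proof
    assume "arcs G = {}"
    moreover have "verts G \<noteq> {}"
      using assms(1)
      by (auto simp: tropical_curve_def Digraph_Component.connected_def strongly_connected_def)
    ultimately show False
      using assms(1) by (auto simp: tropical_curve_def genus_def card_gt_0_iff)
  qed
  then obtain e where e: "e \<in> arcs G" by blast
  then have "(e, 0) \<in> curve_points G len" using len_pos by (simp add: curve_points_def less_imp_le)
  then show ?thesis
    unfolding unpointed_ceresa_class_def using class_eq by (intro the_equality) blast+
qed

end
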